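(* Let $D,E$ be coalgebras over a field and $M$ a $D$-$E$-bicomodule. Then the upper triangular comatrix coalgebra $C=\left(\begin{array}{cc} D & M \\ 0 & E\end{array}\right)$ is left (respectively, right) Artinian if and only if $D,E$ are left (respectively, right) Artinian coalgebras and $M$ is a finitely cogenerated left $D$-comodule (respectively, a finitely cogenerated right $E$-comodule).
   Context: For coalgebras $D,E$ and a $D$-$E$-bicomodule $M$ with left coaction $m\mapsto m_{[-1]}\otimes m_{[0]}\in D\otimes M$ and right coaction $m\mapsto m_{(0)}\otimes m_{(1)}\in M\otimes E$, the upper triangular comatrix coalgebra $\left(\begin{array}{cc} D & M \\ 0 & E \end{array}\right)$ is the vector space $D\oplus M\oplus E$ with comultiplication $\Delta(d)=d_1\otimes d_2$, $\Delta(m)=m_{[-1]}\otimes m_{[0]}+m_{(0)}\otimes m_{(1)}$, $\Delta(e)=e_1\otimes e_2$ for $d\in D$, $m\in M$, $e\in E$, and counit $\varepsilon(d+m+e)=\varepsilon_D(d)+\varepsilon_E(e)$. A coalgebra is left (right) Artinian if it is Artinian (descending chain condition on subcomodules) as a left (right) comodule over itself. A left (right) comodule over a coalgebra $D$ is finitely cogenerated if it embeds, as a left (right) comodule, in $D^n$ for some positive integer $n$. *)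

theory Defs
  imports "HOL-Analysis.Product_Vector" "HOL-Library.Function_Algebras"
begin

section \<open>Tensor products of vector spaces\<close>

text \<open>
  Vector spaces are whole types equipped with a scalar multiplication over a field \<open>'k\<close>.
  The tensor product of \<open>V\<close> and \<open>W\<close> is constructed inside the space of functions on the bilinear
  forms of \<open>V \<times> W\<close>: the tensor of \<open>v\<close> and \<open>w\<close> is evaluation at \<open>(v, w)\<close>, and the tensor product
  is the linear span of these evaluations. The universal property is proved below
  (\<open>tensor_universal\<close>, and \<open>tensor3_universal\<close> for triple tensor products).
  The value at arguments that are not bilinear is fixed to be \<open>0\<close>.
\<close>

definition fun_scale :: "('k \<Rightarrow> 'v \<Rightarrow> 'v) \<Rightarrow> 'k \<Rightarrow> ('x \<Rightarrow> 'v) \<Rightarrow> 'x \<Rightarrow> 'v" where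
  "fun_scale s c f = (\<lambda>x. s c (f x))"

definition bilinear_map ::
  "('k::field \<Rightarrow> 'v::ab_group_add \<Rightarrow> 'v) \<Rightarrow> ('k \<Rightarrow> 'w::ab_group_add \<Rightarrow> 'w) \<Rightarrow>
   ('k \<Rightarrow> 'u::ab_group_add \<Rightarrow> 'u) \<Rightarrow> ('v \<Rightarrow> 'w \<Rightarrow> 'u) \<Rightarrow> bool" where
  "bilinear_map s t u B \<longleftrightarrow>
     (\<forall>w. Vector_Spaces.linear s u (\<lambda>v. B v w)) \<and> (\<forall>v. Vector_Spaces.linear t u (\<lambda>w. B v w))"

definition trilinear_map ::
  "('k::field \<Rightarrow> 'v::ab_group_add \<Rightarrow> 'v) \<Rightarrow> ('k \<Rightarrow> 'w::ab_group_add \<Rightarrow> 'w) \<Rightarrow>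
   ('k \<Rightarrow> 'x::ab_group_add \<Rightarrow> 'x) \<Rightarrow> ('k \<Rightarrow> 'u::ab_group_add \<Rightarrow> 'u) \<Rightarrow>
   ('v \<Rightarrow> 'w \<Rightarrow> 'x \<Rightarrow> 'u) \<Rightarrow> bool" where
  "trilinear_map r s t u B \<longleftrightarrow>
     (\<forall>w x. Vector_Spaces.linear r u (\<lambda>v. B v w x)) \<and>
     (\<forall>v x. Vector_Spaces.linear s u (\<lambda>w. B v w x)) \<and>
     (\<forall>v w. Vector_Spaces.linear t u (\<lambda>x. B v w x))"

type_synonym ('v, 'w, 'k) tensor = "('v \<Rightarrow> 'w \<Rightarrow> 'k) \<Rightarrow> 'k"
type_synonym ('v, 'w, 'x, 'k) tensor3 = "('v \<Rightarrow> 'w \<Rightarrow> 'x \<Rightarrow> 'k) \<Rightarrow> 'k"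

abbreviation tensor_scale :: "'k::field \<Rightarrow> ('x \<Rightarrow> 'k) \<Rightarrow> 'x \<Rightarrow> 'k" where
  "tensor_scale \<equiv> fun_scale (*)"

definition tensor ::
  "('k::field \<Rightarrow> 'v::ab_group_add \<Rightarrow> 'v) \<Rightarrow> ('k \<Rightarrow> 'w::ab_group_add \<Rightarrow> 'w) \<Rightarrow>
   'v \<Rightarrow> 'w \<Rightarrow> ('v, 'w, 'k) tensor" where
  "tensor s t v w = (\<lambda>B. if bilinear_map s t (*) B then B v w else 0)"

definition tensor3 ::
  "('k::field \<Rightarrow> 'v::ab_group_add \<Rightarrow> 'v) \<Rightarrow> ('k \<Rightarrow> 'w::ab_group_add \<Rightarrow> 'w) \<Rightarrow>
   ('k \<Rightarrow> 'x::ab_group_add \<Rightarrow> 'x) \<Rightarrow> 'v \<Rightarrow> 'w \<Rightarrow> 'x \<Rightarrow> ('v, 'w, 'x, 'k) tensor3" where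
  "tensor3 r s t v w x = (\<lambda>B. if trilinear_map r s t (*) B then B v w x else 0)"

text \<open>
  For subspaces \<open>P\<close> of \<open>V\<close> and \<open>Q\<close> of \<open>W\<close>, this is the image of the tensor product of
  \<open>P\<close> and \<open>Q\<close> in that of \<open>V\<close> and \<open>W\<close>.
\<close>
definition tensor_space ::
  "('k::field \<Rightarrow> 'v::ab_group_add \<Rightarrow> 'v) \<Rightarrow> ('k \<Rightarrow> 'w::ab_group_add \<Rightarrow> 'w) \<Rightarrow>
   'v set \<Rightarrow> 'w set \<Rightarrow> ('v, 'w, 'k) tensor set" where
  "tensor_space s t P Q = module.span tensor_scale {tensor s t v w | v w. v \<in> P \<and> w \<in> Q}"

text \<open>\<open>f \<otimes> g\<close> for linear \<open>f\<close>, \<open>g\<close>; the scalar multiplications are those of the codomains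
  (see \<open>tensor_map_tensor\<close>).\<close>
definition tensor_map ::
  "('k::field \<Rightarrow> 'v'::ab_group_add \<Rightarrow> 'v') \<Rightarrow> ('k \<Rightarrow> 'w'::ab_group_add \<Rightarrow> 'w') \<Rightarrow>
   ('v \<Rightarrow> 'v') \<Rightarrow> ('w \<Rightarrow> 'w') \<Rightarrow> ('v, 'w, 'k) tensor \<Rightarrow> ('v', 'w', 'k) tensor" where
  "tensor_map s t f g T =
     (\<lambda>B. if bilinear_map s t (*) B then T (\<lambda>v w. B (f v) (g w)) else 0)"

text \<open>
  \<open>f \<otimes> id : V \<otimes> X \<rightarrow> A \<otimes> B \<otimes> X\<close> for \<open>f : V \<rightarrow> A \<otimes> B\<close>, and
  \<open>id \<otimes> g : V \<otimes> X \<rightarrow> V \<otimes> A \<otimes> B\<close> for \<open>g : X \<rightarrow> A \<otimes> B\<close>, with the iterated tensor products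
  \<open>(A \<otimes> B) \<otimes> X\<close> and \<open>V \<otimes> (A \<otimes> B)\<close> identified with the unbracketed triple tensor products
  (see \<open>tensor_lift_left_tensor\<close>, \<open>tensor_lift_right_tensor\<close>).
\<close>
definition tensor_lift_left ::
  "('k::field \<Rightarrow> 'a::ab_group_add \<Rightarrow> 'a) \<Rightarrow> ('k \<Rightarrow> 'b::ab_group_add \<Rightarrow> 'b) \<Rightarrow>
   ('k \<Rightarrow> 'x::ab_group_add \<Rightarrow> 'x) \<Rightarrow> ('v \<Rightarrow> ('a, 'b, 'k) tensor) \<Rightarrow>
   ('v, 'x, 'k) tensor \<Rightarrow> ('a, 'b, 'x, 'k) tensor3" where
  "tensor_lift_left r s t f T =
     (\<lambda>B. if trilinear_map r s t (*) B then T (\<lambda>v x. f v (\<lambda>a b. B a b x)) else 0)"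

definition tensor_lift_right ::
  "('k::field \<Rightarrow> 'v::ab_group_add \<Rightarrow> 'v) \<Rightarrow> ('k \<Rightarrow> 'a::ab_group_add \<Rightarrow> 'a) \<Rightarrow>
   ('k \<Rightarrow> 'b::ab_group_add \<Rightarrow> 'b) \<Rightarrow> ('x \<Rightarrow> ('a, 'b, 'k) tensor) \<Rightarrow>
   ('v, 'x, 'k) tensor \<Rightarrow> ('v, 'a, 'b, 'k) tensor3" where
  "tensor_lift_right r s t g T =
     (\<lambda>B. if trilinear_map r s t (*) B then T (\<lambda>v x. g x (\<lambda>a b. B v a b)) else 0)"

subsection \<open>Justification of the construction\<close>

lemma vector_space_field: "vector_space ((*) :: 'k::field \<Rightarrow> 'k \<Rightarrow> 'k)"
  by unfold_locales (simp_all add: algebra_simps)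

lemma vector_space_fun_scale: "vector_space s \<Longrightarrow> vector_space (fun_scale s)"
  unfolding vector_space_def fun_scale_def by (auto simp: fun_eq_iff)

lemma vector_space_tensor_scale [simp]:
  "vector_space (tensor_scale :: 'k::field \<Rightarrow> ('x \<Rightarrow> 'k) \<Rightarrow> _)"
  by (rule vector_space_fun_scale) (rule vector_space_field)

lemma linear_iffs:
  "Vector_Spaces.linear s t f \<longleftrightarrow> vector_space s \<and> vector_space t \<and>
     (\<forall>x y. f (x + y) = f x + f y) \<and> (\<forall>c x. f (s c x) = t c (f x))"
  unfolding Vector_Spaces.linear_iff by blast

lemma evaluation_universal:
  fixes u :: "'k::field \<Rightarrow> 'u::ab_group_add \<Rightarrow> 'u"
    and ev :: "'x \<Rightarrow> ('f \<Rightarrow> 'k)" and h :: "'x \<Rightarrow> 'u"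
  assumes u: "vector_space u"
    and test: "\<And>\<phi>. Vector_Spaces.linear u (*) \<phi> \<Longrightarrow> \<exists>F. \<forall>x. ev x F = \<phi> (h x)"
  shows "\<exists>L. Vector_Spaces.linear tensor_scale u L \<and> (\<forall>x. L (ev x) = h x)"
proof -
  interpret K: vector_space "(*) :: 'k \<Rightarrow> 'k \<Rightarrow> 'k" by (rule vector_space_field)
  interpret T: vector_space "tensor_scale :: 'k \<Rightarrow> ('f \<Rightarrow> 'k) \<Rightarrow> _"
    by (rule vector_space_tensor_scale)
  interpret U: vector_space u by (rule u)
  interpret UK: vector_space_pair u "(*) :: 'k \<Rightarrow> 'k \<Rightarrow> 'k" by unfold_locales
  interpret TU: vector_space_pair "tensor_scale :: 'k \<Rightarrow> ('f \<Rightarrow> 'k) \<Rightarrow> _" u by unfold_locales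
  have sep: "y = 0" if "\<And>\<phi>. Vector_Spaces.linear u (*) \<phi> \<Longrightarrow> \<phi> y = 0" for y
  proof (rule ccontr)
    assume y: "y \<noteq> 0"
    then have "U.independent {y}" by simp
    then obtain \<phi> where "Vector_Spaces.linear u (*) \<phi>" "\<phi> y = (1::'k)"
      using UK.linear_independent_extend[of "{y}" "\<lambda>_. 1"] by auto
    with that show False by fastforce
  qed
  have eval: "tensor_scale c v F = c * v F" for c :: 'k and v :: "'f \<Rightarrow> 'k" and F
    by (simp add: fun_scale_def)
  obtain S where S: "S \<subseteq> range ev" "T.independent S" "range ev \<subseteq> T.span S"
    using T.maximal_independent_subset by blast
  define g where "g b = h (SOME x. ev x = b)" for b
  obtain L where L: "Vector_Spaces.linear tensor_scale u L" and Lg: "\<And>b. b \<in> S \<Longrightarrow> L b = g b"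
    using TU.linear_independent_extend[OF S(2), of g] by blast
  interpret L: Vector_Spaces.linear tensor_scale u L by (rule L)
  have "L (ev x) = h x" for x
  proof -
    obtain A r where A: "finite A" "A \<subseteq> S" "ev x = (\<Sum>a\<in>A. tensor_scale (r a) a)"
      using subsetD[OF S(3) rangeI[of ev x]] unfolding T.span_explicit by blast
    have evg: "\<exists>z. ev z = a \<and> h z = g a" if "a \<in> A" for a
    proof -
      have "a \<in> range ev" using that A(2) S(1) by blast
      then have "ev (SOME z. ev z = a) = a" by (metis (mono_tags, lifting) imageE someI)
      then show ?thesis unfolding g_def by blast
    qed
    have Lx: "L (ev x) = (\<Sum>a\<in>A. u (r a) (g a))"
      unfolding A(3) L.sum using Lg A(2) by (auto intro!: sum.cong simp: L.scale)
    have "h x - L (ev x) = 0"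
    proof (rule sep)
      fix \<phi> assume phi: "Vector_Spaces.linear u (*) \<phi>"
      interpret phi: Vector_Spaces.linear u "(*)" \<phi> by (rule phi)
      obtain F where F: "\<And>x. ev x F = \<phi> (h x)" using test[OF phi] by blast
      have fsum: "(\<Sum>a\<in>A. tensor_scale (r a) a) F = (\<Sum>a\<in>A. r a * a F)"
        using A(1) by induction (simp_all add: eval)
      have "\<phi> (h x) = (\<Sum>a\<in>A. r a * a F)" using F[of x] unfolding A(3) fsum by simp
      also have "\<dots> = (\<Sum>a\<in>A. r a * \<phi> (g a))"
        by (rule sum.cong) (use evg F in metis)+
      also have "\<dots> = \<phi> (L (ev x))" unfolding Lx by (simp add: phi.sum phi.scale)
      finally show "\<phi> (h x - L (ev x)) = 0" by (simp add: phi.diff)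
    qed
    then show ?thesis by simp
  qed
  with L show ?thesis by blast
qed

lemma bilinear_tensor:
  assumes "vector_space s" "vector_space t"
  shows "bilinear_map s t tensor_scale (tensor s t)"
  using assms
  by (simp add: bilinear_map_def linear_iffs)
    (simp add: tensor_def fun_scale_def fun_eq_iff bilinear_map_def linear_iffs)

lemma tensor_universal:
  assumes B: "bilinear_map s t u B"
  shows "\<exists>L. Vector_Spaces.linear tensor_scale u L \<and> (\<forall>v w. L (tensor s t v w) = B v w)"
proof -
  have "\<exists>L. Vector_Spaces.linear tensor_scale u L \<and>
      (\<forall>p. L ((\<lambda>(v, w). tensor s t v w) p) = (\<lambda>(v, w). B v w) p)"
  proof (rule evaluation_universal)
    show "vector_space u" using B by (simp add: bilinear_map_def linear_iffs)
    fix \<phi> assume "Vector_Spaces.linear u (*) \<phi>"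
    then have "bilinear_map s t (*) (\<lambda>v w. \<phi> (B v w))"
      using B by (simp add: bilinear_map_def linear_iffs)
    then show "\<exists>F. \<forall>p. (\<lambda>(v, w). tensor s t v w) p F = \<phi> ((\<lambda>(v, w). B v w) p)"
      by (intro exI[of _ "\<lambda>v w. \<phi> (B v w)"]) (simp add: tensor_def split: prod.split)
  qed
  then show ?thesis by auto
qed

lemma tensor3_universal:
  assumes B: "trilinear_map r s t u B"
  shows "\<exists>L. Vector_Spaces.linear tensor_scale u L \<and> (\<forall>v w x. L (tensor3 r s t v w x) = B v w x)"
proof -
  have "\<exists>L. Vector_Spaces.linear tensor_scale u L \<and>
      (\<forall>p. L ((\<lambda>(v, w, x). tensor3 r s t v w x) p) = (\<lambda>(v, w, x). B v w x) p)"
  proof (rule evaluation_universal)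
    show "vector_space u" using B by (simp add: trilinear_map_def linear_iffs)
    fix \<phi> assume "Vector_Spaces.linear u (*) \<phi>"
    then have "trilinear_map r s t (*) (\<lambda>v w x. \<phi> (B v w x))"
      using B by (simp add: trilinear_map_def linear_iffs)
    then show "\<exists>F. \<forall>p. (\<lambda>(v, w, x). tensor3 r s t v w x) p F = \<phi> ((\<lambda>(v, w, x). B v w x) p)"
      by (intro exI[of _ "\<lambda>v w x. \<phi> (B v w x)"]) (simp add: tensor3_def split: prod.split)
  qed
  then show ?thesis by auto
qed

lemma bilinear_map_comp:
  assumes "bilinear_map s' t' u B" "Vector_Spaces.linear s s' f" "Vector_Spaces.linear t t' g"
  shows "bilinear_map s t u (\<lambda>v w. B (f v) (g w))"
proof -
  show ?thesis
    unfolding bilinear_map_def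
  proof (intro conjI allI)
    fix w
    have "Vector_Spaces.linear s' u (\<lambda>v. B v (g w))"
      using assms(1) by (simp add: bilinear_map_def)
    with assms(2) show "Vector_Spaces.linear s u (\<lambda>v. B (f v) (g w))"
      using Vector_Spaces.linear_compose[of s s' f u "\<lambda>v. B v (g w)"] by (simp add: o_def)
  next
    fix v
    have "Vector_Spaces.linear t' u (\<lambda>w. B (f v) w)"
      using assms(1) by (simp add: bilinear_map_def)
    with assms(3) show "Vector_Spaces.linear t u (\<lambda>w. B (f v) (g w))"
      using Vector_Spaces.linear_compose[of t t' g u "\<lambda>w. B (f v) w"] by (simp add: o_def)
  qed
qed

lemma tensor_map_tensor:
  assumes "Vector_Spaces.linear s s' f" "Vector_Spaces.linear t t' g"
  shows "tensor_map s' t' f g (tensor s t v w) = tensor s' t' (f v) (g w)"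
proof
  fix B
  show "tensor_map s' t' f g (tensor s t v w) B = tensor s' t' (f v) (g w) B"
    using bilinear_map_comp[OF _ assms, of "(*)" B]
    by (cases "bilinear_map s' t' (*) B") (simp_all add: tensor_map_def tensor_def)
qed

lemma tensor_map_linear:
  "Vector_Spaces.linear tensor_scale tensor_scale (tensor_map s t f g)"
proof -
  have "tensor_map s t f g (S + T) = tensor_map s t f g S + tensor_map s t f g T" for S T
    by (rule ext) (simp add: tensor_map_def)
  moreover have "tensor_map s t f g (tensor_scale c T) = tensor_scale c (tensor_map s t f g T)"
    for c T
    by (rule ext) (simp add: tensor_map_def fun_scale_def)
  ultimately show ?thesis
    by (simp add: linear_iffs)
qed

lemma tensor_space_induct [consumes 1, case_names zero add scale tensor]:
  assumes "T \<in> tensor_space s t X Y"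
    and "P 0" "\<And>S T. P S \<Longrightarrow> P T \<Longrightarrow> P (S + T)" "\<And>c T. P T \<Longrightarrow> P (tensor_scale c T)"
    and "\<And>v w. v \<in> X \<Longrightarrow> w \<in> Y \<Longrightarrow> P (tensor s t v w)"
  shows "P T"
proof -
  interpret vector_space tensor_scale
    by (rule vector_space_tensor_scale)
  have "T \<in> span {tensor s t v w | v w. v \<in> X \<and> w \<in> Y}"
    using assms(1) by (simp add: tensor_space_def)
  moreover have "subspace (Collect P)"
    unfolding subspace_def mem_Collect_eq using assms(2-4) by (intro conjI ballI allI) simp_all
  moreover have "{tensor s t v w | v w. v \<in> X \<and> w \<in> Y} \<subseteq> Collect P" using assms(5) by blast
  ultimately show ?thesis using span_minimal[of _ "Collect P"] by blast
qed

text \<open>Elements of the tensor product are linear on bilinear forms.\<close>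
lemma tensor_space_linear:
  assumes "T \<in> tensor_space s t X Y"
  shows "bilinear_map s t (*) A \<Longrightarrow> bilinear_map s t (*) B \<Longrightarrow>
           T (\<lambda>v w. A v w + B v w) = T A + T B"
    and "bilinear_map s t (*) A \<Longrightarrow> T (\<lambda>v w. c * A v w) = c * T A"
    and "\<not> bilinear_map s t (*) A \<Longrightarrow> T A = 0"
proof -
  show "T (\<lambda>v w. A v w + B v w) = T A + T B"
    if A: "bilinear_map s t (*) A" and B: "bilinear_map s t (*) B"
  proof -
    have AB: "bilinear_map s t (*) (\<lambda>v w. A v w + B v w)"
      using A B by (simp add: bilinear_map_def linear_iffs algebra_simps)
    show ?thesis
      using assms
    proof (induction rule: tensor_space_induct)
      case (scale c T)
      then show ?case by (simp only: fun_scale_def distrib_left)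
    next
      case (tensor v w)
      show ?case by (simp only: tensor_def A B AB if_True)
    qed simp_all
  qed
  show "T (\<lambda>v w. c * A v w) = c * T A" if A: "bilinear_map s t (*) A"
  proof -
    have cA: "bilinear_map s t (*) (\<lambda>v w. c * A v w)"
      using A by (simp add: bilinear_map_def linear_iffs algebra_simps)
    show ?thesis
      using assms
    proof (induction rule: tensor_space_induct)
      case (add S T)
      then show ?case by (simp add: distrib_left)
    next
      case (scale d T)
      then show ?case by (simp add: fun_scale_def)
    next
      case (tensor v w)
      show ?case by (simp only: tensor_def A cA if_True)
    qed simp_all
  qed
  show "T A = 0" if "\<not> bilinear_map s t (*) A"
    using assms
  proof (induction rule: tensor_space_induct)
    case (tensor v w)
    show ?case using that by (simp add: tensor_def)
  qed (simp_all add: fun_scale_def)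
qed

lemma trilinear_map_fix:
  assumes "trilinear_map r s t u B"
  shows "bilinear_map r s u (\<lambda>a b. B a b x)" "bilinear_map s t u (\<lambda>a b. B y a b)"
  using assms unfolding trilinear_map_def bilinear_map_def by blast+

lemma bilinear_lift_left:
  assumes B: "trilinear_map r s t (*) B" and f: "Vector_Spaces.linear p tensor_scale f"
    and fT: "\<And>v. f v \<in> tensor_space r s UNIV UNIV"
  shows "bilinear_map p t (*) (\<lambda>v x. f v (\<lambda>a b. B a b x))"
proof -
  have eq: "(\<lambda>a b. B a b (x + y)) = (\<lambda>a b. B a b x + B a b y)"
    "(\<lambda>a b. B a b (t c x)) = (\<lambda>a b. c * B a b x)" for x y c
    using B by (simp_all add: trilinear_map_def linear_iffs)
  show ?thesis
    using f B unfolding bilinear_map_def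
    by (auto simp: linear_iffs fun_scale_def eq trilinear_map_def
      tensor_space_linear(1,2)[OF fT trilinear_map_fix(1)[OF B]]
      tensor_space_linear(1)[OF fT trilinear_map_fix(1)[OF B] trilinear_map_fix(1)[OF B]])
qed

lemma bilinear_lift_right:
  assumes B: "trilinear_map r s t (*) B" and f: "Vector_Spaces.linear p tensor_scale f"
    and fT: "\<And>v. f v \<in> tensor_space s t UNIV UNIV"
  shows "bilinear_map r p (*) (\<lambda>v x. f x (\<lambda>a b. B v a b))"
proof -
  have eq: "(\<lambda>a b. B (x + y) a b) = (\<lambda>a b. B x a b + B y a b)"
    "(\<lambda>a b. B (r c x) a b) = (\<lambda>a b. c * B x a b)" for x y c
    using B by (simp_all add: trilinear_map_def linear_iffs)
  show ?thesis
    using f B unfolding bilinear_map_def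
    by (auto simp: linear_iffs fun_scale_def eq trilinear_map_def
      tensor_space_linear(2)[OF fT trilinear_map_fix(2)[OF B]]
      tensor_space_linear(1)[OF fT trilinear_map_fix(2)[OF B] trilinear_map_fix(2)[OF B]])
qed

lemma fun_sum_apply: "(\<Sum>i\<in>I. f i) x = (\<Sum>i\<in>I. f i x)"
  for f :: "'i \<Rightarrow> 'x \<Rightarrow> 'y::comm_monoid_add"
  by (induction I rule: infinite_finite_induct) auto

lemma tensor_lift_left_tensor:
  assumes f: "Vector_Spaces.linear p tensor_scale f" "\<And>v. f v \<in> tensor_space r s UNIV UNIV"
    and fv: "f v = (\<Sum>i\<in>I. tensor r s (a i) (b i))"
  shows "tensor_lift_left r s t f (tensor p t v x) = (\<Sum>i\<in>I. tensor3 r s t (a i) (b i) x)"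
proof
  fix B
  show "tensor_lift_left r s t f (tensor p t v x) B = (\<Sum>i\<in>I. tensor3 r s t (a i) (b i) x) B"
  proof (cases "trilinear_map r s t (*) B")
    case True
    then show ?thesis
      using bilinear_lift_left[OF True f] trilinear_map_fix(1)[OF True]
      by (simp add: tensor_lift_left_def tensor_def tensor3_def fv fun_sum_apply)
  qed (simp add: tensor_lift_left_def tensor3_def fun_sum_apply)
qed

lemma tensor_lift_right_tensor:
  assumes f: "Vector_Spaces.linear p tensor_scale g" "\<And>v. g v \<in> tensor_space s t UNIV UNIV"
    and gx: "g x = (\<Sum>i\<in>I. tensor s t (a i) (b i))"
  shows "tensor_lift_right r s t g (tensor r p v x) = (\<Sum>i\<in>I. tensor3 r s t v (a i) (b i))"
proof
  fix B
  show "tensor_lift_right r s t g (tensor r p v x) B = (\<Sum>i\<in>I. tensor3 r s t v (a i) (b i)) B"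
  proof (cases "trilinear_map r s t (*) B")
    case True
    then show ?thesis
      using bilinear_lift_right[OF True f] trilinear_map_fix(2)[OF True]
      by (simp add: tensor_lift_right_def tensor_def tensor3_def gx fun_sum_apply)
  qed (simp add: tensor_lift_right_def tensor3_def fun_sum_apply)
qed


section \<open>Coalgebras, comodules and bicomodules\<close>

locale coalgebra =
  fixes scale :: "'k::field \<Rightarrow> 'c::ab_group_add \<Rightarrow> 'c"
    and comult :: "'c \<Rightarrow> ('c, 'c, 'k) tensor"
    and counit :: "'c \<Rightarrow> 'k"
  assumes linear_comult: "Vector_Spaces.linear scale tensor_scale comult"
    and comult_in: "comult c \<in> tensor_space scale scale UNIV UNIV"
    and linear_counit: "Vector_Spaces.linear scale (*) counit"
    and coassoc: "tensor_lift_left scale scale scale comult (comult c) =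
                  tensor_lift_right scale scale scale comult (comult c)"
    and counit_left: "tensor_map (*) scale counit id (comult c) = tensor (*) scale 1 c"
    and counit_right: "tensor_map scale (*) id counit (comult c) = tensor scale (*) c 1"

locale left_comodule = coalgebra scaleD comultD counitD
  for scaleD :: "'k::field \<Rightarrow> 'd::ab_group_add \<Rightarrow> 'd" and comultD and counitD +
  fixes scaleM :: "'k \<Rightarrow> 'm::ab_group_add \<Rightarrow> 'm"
    and coact :: "'m \<Rightarrow> ('d, 'm, 'k) tensor"
  assumes linear_left_coact: "Vector_Spaces.linear scaleM tensor_scale coact"
    and left_coact_in: "coact m \<in> tensor_space scaleD scaleM UNIV UNIV"
    and left_coact_coassoc: "tensor_lift_left scaleD scaleD scaleM comultD (coact m) =
                             tensor_lift_right scaleD scaleD scaleM coact (coact m)"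
    and left_coact_counit: "tensor_map (*) scaleM counitD id (coact m) = tensor (*) scaleM 1 m"

locale right_comodule = coalgebra scaleE comultE counitE
  for scaleE :: "'k::field \<Rightarrow> 'e::ab_group_add \<Rightarrow> 'e" and comultE and counitE +
  fixes scaleM :: "'k \<Rightarrow> 'm::ab_group_add \<Rightarrow> 'm"
    and coact :: "'m \<Rightarrow> ('m, 'e, 'k) tensor"
  assumes linear_right_coact: "Vector_Spaces.linear scaleM tensor_scale coact"
    and right_coact_in: "coact m \<in> tensor_space scaleM scaleE UNIV UNIV"
    and right_coact_coassoc: "tensor_lift_left scaleM scaleE scaleE coact (coact m) =
                              tensor_lift_right scaleM scaleE scaleE comultE (coact m)"
    and right_coact_counit: "tensor_map scaleM (*) id counitE (coact m) = tensor scaleM (*) m 1"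

locale bicomodule =
  left: left_comodule scaleD comultD counitD scaleM lcoact +
  right: right_comodule scaleE comultE counitE scaleM rcoact
  for scaleD :: "'k::field \<Rightarrow> 'd::ab_group_add \<Rightarrow> 'd" and comultD counitD
    and scaleE :: "'k \<Rightarrow> 'e::ab_group_add \<Rightarrow> 'e" and comultE counitE
    and scaleM :: "'k \<Rightarrow> 'm::ab_group_add \<Rightarrow> 'm" and lcoact rcoact +
  assumes coact_compat: "tensor_lift_left scaleD scaleM scaleE lcoact (rcoact m) =
                         tensor_lift_right scaleD scaleM scaleE rcoact (lcoact m)"

section \<open>Artinian and finitely cogenerated comodules\<close>

text \<open>
  The notions below only depend on the coaction: a subspace \<open>N\<close> of a left \<open>D\<close>-comodule \<open>M\<close> is a
  subcomodule if the coaction maps \<open>N\<close> into \<open>D \<otimes> N\<close>, viewed in \<open>D \<otimes> M\<close>; symmetrically on the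
  right.
\<close>

definition left_subcomodule ::
  "('k::field \<Rightarrow> 'd::ab_group_add \<Rightarrow> 'd) \<Rightarrow> ('k \<Rightarrow> 'm::ab_group_add \<Rightarrow> 'm) \<Rightarrow>
   ('m \<Rightarrow> ('d, 'm, 'k) tensor) \<Rightarrow> 'm set \<Rightarrow> bool" where
  "left_subcomodule sD sM coact N \<longleftrightarrow>
     module.subspace sM N \<and> coact ` N \<subseteq> tensor_space sD sM UNIV N"

definition right_subcomodule ::
  "('k::field \<Rightarrow> 'e::ab_group_add \<Rightarrow> 'e) \<Rightarrow> ('k \<Rightarrow> 'm::ab_group_add \<Rightarrow> 'm) \<Rightarrow>
   ('m \<Rightarrow> ('m, 'e, 'k) tensor) \<Rightarrow> 'm set \<Rightarrow> bool" where
  "right_subcomodule sE sM coact N \<longleftrightarrow>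
     module.subspace sM N \<and> coact ` N \<subseteq> tensor_space sM sE N UNIV"

definition descending_chain_condition :: "('m set \<Rightarrow> bool) \<Rightarrow> bool" where
  "descending_chain_condition P \<longleftrightarrow>
     (\<forall>N :: nat \<Rightarrow> 'm set. (\<forall>i. P (N i)) \<and> (\<forall>i. N (Suc i) \<subseteq> N i) \<longrightarrow> (\<exists>n. \<forall>i\<ge>n. N i = N n))"

definition left_artinian_comodule where
  "left_artinian_comodule sD sM coact \<longleftrightarrow>
     descending_chain_condition (left_subcomodule sD sM coact)"

definition right_artinian_comodule where
  "right_artinian_comodule sE sM coact \<longleftrightarrow>
     descending_chain_condition (right_subcomodule sE sM coact)"

definition left_artinian_coalgebra where
  "left_artinian_coalgebra s comult \<longleftrightarrow> left_artinian_comodule s s comult"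

definition right_artinian_coalgebra where
  "right_artinian_coalgebra s comult \<longleftrightarrow> right_artinian_comodule s s comult"

definition left_comodule_hom ::
  "('k::field \<Rightarrow> 'd::ab_group_add \<Rightarrow> 'd) \<Rightarrow> ('k \<Rightarrow> 'm::ab_group_add \<Rightarrow> 'm) \<Rightarrow>
   ('m \<Rightarrow> ('d, 'm, 'k) tensor) \<Rightarrow> ('k \<Rightarrow> 'n::ab_group_add \<Rightarrow> 'n) \<Rightarrow>
   ('n \<Rightarrow> ('d, 'n, 'k) tensor) \<Rightarrow> ('m \<Rightarrow> 'n) \<Rightarrow> bool" where
  "left_comodule_hom sD sM coactM sN coactN f \<longleftrightarrow>
     Vector_Spaces.linear sM sN f \<and> (\<forall>m. coactN (f m) = tensor_map sD sN id f (coactM m))"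

definition right_comodule_hom ::
  "('k::field \<Rightarrow> 'e::ab_group_add \<Rightarrow> 'e) \<Rightarrow> ('k \<Rightarrow> 'm::ab_group_add \<Rightarrow> 'm) \<Rightarrow>
   ('m \<Rightarrow> ('m, 'e, 'k) tensor) \<Rightarrow> ('k \<Rightarrow> 'n::ab_group_add \<Rightarrow> 'n) \<Rightarrow>
   ('n \<Rightarrow> ('n, 'e, 'k) tensor) \<Rightarrow> ('m \<Rightarrow> 'n) \<Rightarrow> bool" where
  "right_comodule_hom sE sM coactM sN coactN f \<longleftrightarrow>
     Vector_Spaces.linear sM sN f \<and> (\<forall>m. coactN (f m) = tensor_map sN sE f id (coactM m))"

text \<open>
  As the exponent \<open>n\<close> is quantified, \<open>D\<^sup>n\<close> is realised as the subspace of those functions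
  \<open>nat \<Rightarrow> 'd\<close> that vanish from \<open>n\<close> on. Its coaction is the direct sum of \<open>n\<close> copies of the
  comultiplication, \<open>h \<mapsto> \<Sum>i<n. (id \<otimes> \<iota>\<^sub>i) (\<Delta> (h i))\<close>, with \<open>\<iota>\<^sub>i\<close> the inclusion of the \<open>i\<close>-th summand.
\<close>

definition power_space :: "nat \<Rightarrow> (nat \<Rightarrow> 'd::zero) set" where
  "power_space n = {h. \<forall>i\<ge>n. h i = 0}"

definition power_incl :: "nat \<Rightarrow> 'd::zero \<Rightarrow> nat \<Rightarrow> 'd" where
  "power_incl i d = (\<lambda>j. if j = i then d else 0)"

definition left_power_coact ::
  "('k::field \<Rightarrow> 'd::ab_group_add \<Rightarrow> 'd) \<Rightarrow> ('d \<Rightarrow> ('d, 'd, 'k) tensor) \<Rightarrow> nat \<Rightarrow>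
   (nat \<Rightarrow> 'd) \<Rightarrow> ('d, nat \<Rightarrow> 'd, 'k) tensor" where
  "left_power_coact s comult n h =
     (\<Sum>i<n. tensor_map s (fun_scale s) id (power_incl i) (comult (h i)))"

definition right_power_coact ::
  "('k::field \<Rightarrow> 'e::ab_group_add \<Rightarrow> 'e) \<Rightarrow> ('e \<Rightarrow> ('e, 'e, 'k) tensor) \<Rightarrow> nat \<Rightarrow>
   (nat \<Rightarrow> 'e) \<Rightarrow> (nat \<Rightarrow> 'e, 'e, 'k) tensor" where
  "right_power_coact s comult n h =
     (\<Sum>i<n. tensor_map (fun_scale s) s (power_incl i) id (comult (h i)))"

definition left_finitely_cogenerated ::
  "('k::field \<Rightarrow> 'd::ab_group_add \<Rightarrow> 'd) \<Rightarrow> ('d \<Rightarrow> ('d, 'd, 'k) tensor) \<Rightarrow>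
   ('k \<Rightarrow> 'm::ab_group_add \<Rightarrow> 'm) \<Rightarrow> ('m \<Rightarrow> ('d, 'm, 'k) tensor) \<Rightarrow> bool" where
  "left_finitely_cogenerated sD comultD sM coact \<longleftrightarrow>
     (\<exists>n>0. \<exists>f :: 'm \<Rightarrow> nat \<Rightarrow> 'd. inj f \<and> range f \<subseteq> power_space n \<and>
        left_comodule_hom sD sM coact (fun_scale sD) (left_power_coact sD comultD n) f)"

definition right_finitely_cogenerated ::
  "('k::field \<Rightarrow> 'e::ab_group_add \<Rightarrow> 'e) \<Rightarrow> ('e \<Rightarrow> ('e, 'e, 'k) tensor) \<Rightarrow>
   ('k \<Rightarrow> 'm::ab_group_add \<Rightarrow> 'm) \<Rightarrow> ('m \<Rightarrow> ('m, 'e, 'k) tensor) \<Rightarrow> bool" where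
  "right_finitely_cogenerated sE comultE sM coact \<longleftrightarrow>
     (\<exists>n>0. \<exists>f :: 'm \<Rightarrow> nat \<Rightarrow> 'e. inj f \<and> range f \<subseteq> power_space n \<and>
        right_comodule_hom sE sM coact (fun_scale sE) (right_power_coact sE comultE n) f)"

section \<open>The upper triangular comatrix coalgebra\<close>

text \<open>The underlying space \<open>D \<oplus> M \<oplus> E\<close> is the product type \<open>'d \<times> 'm \<times> 'e\<close>.\<close>

definition tri_scale ::
  "('k::field \<Rightarrow> 'd::ab_group_add \<Rightarrow> 'd) \<Rightarrow> ('k \<Rightarrow> 'm::ab_group_add \<Rightarrow> 'm) \<Rightarrow>
   ('k \<Rightarrow> 'e::ab_group_add \<Rightarrow> 'e) \<Rightarrow> 'k \<Rightarrow> 'd \<times> 'm \<times> 'e \<Rightarrow> 'd \<times> 'm \<times> 'e" where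
  "tri_scale sD sM sE = module_prod.scale sD (module_prod.scale sM sE)"

definition in_D :: "'d \<Rightarrow> 'd \<times> 'm::zero \<times> 'e::zero" where "in_D d = (d, 0, 0)"
definition in_M :: "'m \<Rightarrow> 'd::zero \<times> 'm \<times> 'e::zero" where "in_M m = (0, m, 0)"
definition in_E :: "'e \<Rightarrow> 'd::zero \<times> 'm::zero \<times> 'e" where "in_E e = (0, 0, e)"

definition tri_comult ::
  "('k::field \<Rightarrow> 'd::ab_group_add \<Rightarrow> 'd) \<Rightarrow> ('d \<Rightarrow> ('d, 'd, 'k) tensor) \<Rightarrow>
   ('k \<Rightarrow> 'e::ab_group_add \<Rightarrow> 'e) \<Rightarrow> ('e \<Rightarrow> ('e, 'e, 'k) tensor) \<Rightarrow>
   ('k \<Rightarrow> 'm::ab_group_add \<Rightarrow> 'm) \<Rightarrow> ('m \<Rightarrow> ('d, 'm, 'k) tensor) \<Rightarrow>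
   ('m \<Rightarrow> ('m, 'e, 'k) tensor) \<Rightarrow>
   'd \<times> 'm \<times> 'e \<Rightarrow> ('d \<times> 'm \<times> 'e, 'd \<times> 'm \<times> 'e, 'k) tensor" where
  "tri_comult sD comultD sE comultE sM lcoact rcoact = (\<lambda>(d, m, e).
     let s = tri_scale sD sM sE in
       tensor_map s s in_D in_D (comultD d) +
       (tensor_map s s in_D in_M (lcoact m) + tensor_map s s in_M in_E (rcoact m)) +
       tensor_map s s in_E in_E (comultE e))"

definition tri_counit :: "('d \<Rightarrow> 'k::field) \<Rightarrow> ('e \<Rightarrow> 'k) \<Rightarrow> 'd \<times> 'm \<times> 'e \<Rightarrow> 'k" where
  "tri_counit counitD counitE = (\<lambda>(d, m, e). counitD d + counitE e)"

subsection \<open>The comatrix coalgebra is a coalgebra\<close>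

lemma trilinear_map_comp:
  assumes "trilinear_map r' s' t' u B"
    and "Vector_Spaces.linear r r' f" "Vector_Spaces.linear s s' g" "Vector_Spaces.linear t t' h"
  shows "trilinear_map r s t u (\<lambda>v w x. B (f v) (g w) (h x))"
  unfolding trilinear_map_def
proof (intro conjI allI)
  fix w x
  have "Vector_Spaces.linear r' u (\<lambda>v. B v (g w) (h x))"
    using assms(1) by (simp add: trilinear_map_def)
  with assms(2) show "Vector_Spaces.linear r u (\<lambda>v. B (f v) (g w) (h x))"
    using Vector_Spaces.linear_compose[of r r' f u "\<lambda>v. B v (g w) (h x)"] by (simp add: o_def)
next
  fix v x
  have "Vector_Spaces.linear s' u (\<lambda>w. B (f v) w (h x))"
    using assms(1) by (simp add: trilinear_map_def)
  with assms(3) show "Vector_Spaces.linear s u (\<lambda>w. B (f v) (g w) (h x))"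
    using Vector_Spaces.linear_compose[of s s' g u "\<lambda>w. B (f v) w (h x)"] by (simp add: o_def)
next
  fix v w
  have "Vector_Spaces.linear t' u (\<lambda>x. B (f v) (g w) x)"
    using assms(1) by (simp add: trilinear_map_def)
  with assms(4) show "Vector_Spaces.linear t u (\<lambda>x. B (f v) (g w) (h x))"
    using Vector_Spaces.linear_compose[of t t' h u "\<lambda>x. B (f v) (g w) x"] by (simp add: o_def)
qed

lemma tensor_map_in:
  assumes T: "T \<in> tensor_space s t UNIV UNIV"
    and f: "Vector_Spaces.linear s s' f" and g: "Vector_Spaces.linear t t' g"
  shows "tensor_map s' t' f g T \<in> tensor_space s' t' UNIV UNIV"
proof -
  interpret vector_space "tensor_scale"
    by (rule vector_space_tensor_scale)
  interpret L: Vector_Spaces.linear tensor_scale tensor_scale "tensor_map s' t' f g"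
    by (rule tensor_map_linear)
  show ?thesis
    using T
  proof (induction rule: tensor_space_induct)
    case (tensor v w)
    show ?case
      unfolding tensor_map_tensor[OF f g] tensor_space_def by (rule span_base) blast
  qed (simp_all only: L.zero L.add L.scale tensor_space_def span_zero span_add span_scale)
qed

lemma linear_additive: "Vector_Spaces.linear s t f \<Longrightarrow> f (x + y) = f x + f y"
  and linear_scale: "Vector_Spaces.linear s t f \<Longrightarrow> f (s c x) = t c (f x)"
  by (simp_all add: linear_iffs)

lemma linear_0: "Vector_Spaces.linear s t f \<Longrightarrow> f 0 = 0"
  using linear_additive[of s t f 0 0] by simp

lemma tri_scale_eq:
  assumes "vector_space sD" "vector_space sM" "vector_space sE"
  shows "tri_scale sD sM sE = (\<lambda>c (d, m, e). (sD c d, sM c m, sE c e))"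
    and "vector_space (tri_scale sD sM sE)"
proof -
  interpret ME: vector_space_prod sM sE
    using assms by (simp add: vector_space_prod_def vector_space_pair_def)
  interpret DME: vector_space_prod sD "module_prod.scale sM sE"
    using assms ME.p.vector_space_axioms by (simp add: vector_space_prod_def vector_space_pair_def)
  show "tri_scale sD sM sE = (\<lambda>c (d, m, e). (sD c d, sM c m, sE c e))"
    by (rule ext)+ (simp add: tri_scale_def DME.scale_def ME.scale_def split: prod.split)
  show "vector_space (tri_scale sD sM sE)"
    using DME.p.vector_space_axioms by (simp add: tri_scale_def)
qed

context bicomodule
begin

abbreviation (input) "sC \<equiv> tri_scale scaleD scaleM scaleE"
abbreviation (input) "comultC \<equiv> tri_comult scaleD comultD scaleE comultE scaleM lcoact rcoact"

lemma vsD: "vector_space scaleD" and vsE: "vector_space scaleE" and vsM: "vector_space scaleM"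
  using left.linear_comult right.linear_comult left.linear_left_coact by (simp_all add: linear_iffs)

lemmas sC_eq = tri_scale_eq(1)[OF vsD vsM vsE] and vsC = tri_scale_eq(2)[OF vsD vsM vsE]

lemma zero_scale: "scaleD c 0 = 0" "scaleM c 0 = 0" "scaleE c 0 = 0"
  using vsD vsM vsE module.scale_zero_right module_iff_vector_space by metis+

lemma linear_in:
  "Vector_Spaces.linear scaleD sC in_D" "Vector_Spaces.linear scaleM sC in_M"
  "Vector_Spaces.linear scaleE sC in_E"
  using vsD vsM vsE vsC
  by (simp_all add: linear_iffs) (simp_all add: in_D_def in_M_def in_E_def sC_eq zero_scale)

lemma comultC_eval:
  assumes "bilinear_map sC sC (*) B"
  shows "comultC (d, m, e) B =
    comultD d (\<lambda>a b. B (in_D a) (in_D b)) +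
    (lcoact m (\<lambda>a b. B (in_D a) (in_M b)) + rcoact m (\<lambda>a b. B (in_M a) (in_E b))) +
    comultE e (\<lambda>a b. B (in_E a) (in_E b))"
  using assms by (simp add: tri_comult_def Let_def tensor_map_def)

lemma zeros: "comultD 0 = 0" "comultE 0 = 0" "lcoact 0 = 0" "rcoact 0 = 0"
  using linear_0[OF left.linear_comult] linear_0[OF right.linear_comult]
    linear_0[OF left.linear_left_coact] linear_0[OF right.linear_right_coact] by simp_all

lemma comultC_in:
  assumes "bilinear_map sC sC (*) B"
  shows "comultC (in_D d) B = comultD d (\<lambda>a b. B (in_D a) (in_D b))"
    and "comultC (in_M m) B =
      lcoact m (\<lambda>a b. B (in_D a) (in_M b)) + rcoact m (\<lambda>a b. B (in_M a) (in_E b))"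
    and "comultC (in_E e) B = comultE e (\<lambda>a b. B (in_E a) (in_E b))"
  unfolding in_D_def[of d] in_M_def[of m] in_E_def[of e] comultC_eval[OF assms]
  by (simp_all add: zeros)

lemma linear_comultC: "Vector_Spaces.linear sC tensor_scale comultC"
proof -
  have "comultC (x + y) = comultC x + comultC y" for x y
    by (cases x, cases y)
      (simp add: tri_comult_def Let_def linear_additive[OF tensor_map_linear]
        linear_additive[OF left.linear_comult] linear_additive[OF right.linear_comult]
        linear_additive[OF left.linear_left_coact] linear_additive[OF right.linear_right_coact])
  moreover have "comultC (sC c x) = tensor_scale c (comultC x)" for c x
  proof -
    obtain d m e where x: "x = (d, m, e)" by (cases x)
    have "tensor_scale c (S + T) = tensor_scale c S + tensor_scale c T"
      for S T :: "('d \<times> 'm \<times> 'e, 'd \<times> 'm \<times> 'e, 'k) tensor"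
      by (rule ext) (simp add: fun_scale_def distrib_left)
    then show ?thesis unfolding x
      by (simp add: sC_eq tri_comult_def Let_def linear_scale[OF tensor_map_linear]
        linear_scale[OF left.linear_comult] linear_scale[OF right.linear_comult]
        linear_scale[OF left.linear_left_coact] linear_scale[OF right.linear_right_coact])
  qed
  ultimately show ?thesis using vsC by (simp add: linear_iffs)
qed

lemma comultC_in_space: "comultC x \<in> tensor_space sC sC UNIV UNIV"
proof -
  interpret vector_space "tensor_scale :: 'k \<Rightarrow> ('d \<times> 'm \<times> 'e, 'd \<times> 'm \<times> 'e, 'k) tensor \<Rightarrow> _"
    by (rule vector_space_tensor_scale)
  obtain d m e where x: "x = (d, m, e)" by (cases x)
  have "tensor_map sC sC in_D in_D (comultD d) \<in> tensor_space sC sC UNIV UNIV"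
    "tensor_map sC sC in_D in_M (lcoact m) \<in> tensor_space sC sC UNIV UNIV"
    "tensor_map sC sC in_M in_E (rcoact m) \<in> tensor_space sC sC UNIV UNIV"
    "tensor_map sC sC in_E in_E (comultE e) \<in> tensor_space sC sC UNIV UNIV"
    by (rule tensor_map_in[OF left.comult_in linear_in(1) linear_in(1)]
      tensor_map_in[OF left.left_coact_in linear_in(1) linear_in(2)]
      tensor_map_in[OF right.right_coact_in linear_in(2) linear_in(3)]
      tensor_map_in[OF right.comult_in linear_in(3) linear_in(3)])+
  then show ?thesis
    unfolding x tri_comult_def Let_def prod.case tensor_space_def by (intro span_add)
qed

lemma coassocC:
  "tensor_lift_left sC sC sC comultC (comultC x) = tensor_lift_right sC sC sC comultC (comultC x)"
proof
  fix B
  obtain d m e where x: "x = (d, m, e)" by (cases x)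
  show "tensor_lift_left sC sC sC comultC (comultC x) B =
        tensor_lift_right sC sC sC comultC (comultC x) B"
  proof (cases "trilinear_map sC sC sC (*) B")
    case B: True
    note bl = trilinear_map_fix(1)[OF B] and br = trilinear_map_fix(2)[OF B]
    note L = bilinear_lift_left[OF B linear_comultC comultC_in_space]
    note R = bilinear_lift_right[OF B linear_comultC comultC_in_space]
    note tc = trilinear_map_comp[OF B]
    have DDD: "comultD d (\<lambda>c z. comultD c (\<lambda>a b. B (in_D a) (in_D b) (in_D z))) =
        comultD d (\<lambda>z c. comultD c (\<lambda>a b. B (in_D z) (in_D a) (in_D b)))"
      using fun_cong[OF left.coassoc, of d "\<lambda>a b c. B (in_D a) (in_D b) (in_D c)"]
        tc[OF linear_in(1) linear_in(1) linear_in(1)]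
      by (simp add: tensor_lift_left_def tensor_lift_right_def)
    have EEE: "comultE e (\<lambda>c z. comultE c (\<lambda>a b. B (in_E a) (in_E b) (in_E z))) =
        comultE e (\<lambda>z c. comultE c (\<lambda>a b. B (in_E z) (in_E a) (in_E b)))"
      using fun_cong[OF right.coassoc, of e "\<lambda>a b c. B (in_E a) (in_E b) (in_E c)"]
        tc[OF linear_in(3) linear_in(3) linear_in(3)]
      by (simp add: tensor_lift_left_def tensor_lift_right_def)
    note tDDM = tc[OF linear_in(1) linear_in(1) linear_in(2)]
      and tMEE = tc[OF linear_in(2) linear_in(3) linear_in(3)]
      and tDME = tc[OF linear_in(1) linear_in(2) linear_in(3)]
    have DDM: "lcoact m (\<lambda>c z. comultD c (\<lambda>a b. B (in_D a) (in_D b) (in_M z))) =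
        lcoact m (\<lambda>z c. lcoact c (\<lambda>a b. B (in_D z) (in_D a) (in_M b)))"
      using fun_cong[OF left.left_coact_coassoc, of m "\<lambda>a b c. B (in_D a) (in_D b) (in_M c)"] tDDM
      by (simp add: tensor_lift_left_def tensor_lift_right_def)
    have MEE: "rcoact m (\<lambda>c z. rcoact c (\<lambda>a b. B (in_M a) (in_E b) (in_E z))) =
        rcoact m (\<lambda>z c. comultE c (\<lambda>a b. B (in_M z) (in_E a) (in_E b)))"
      using fun_cong[OF right.right_coact_coassoc, of m "\<lambda>a b c. B (in_M a) (in_E b) (in_E c)"] tMEE
      by (simp add: tensor_lift_left_def tensor_lift_right_def)
    have DME: "rcoact m (\<lambda>c z. lcoact c (\<lambda>a b. B (in_D a) (in_M b) (in_E z))) =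
        lcoact m (\<lambda>z c. rcoact c (\<lambda>a b. B (in_D z) (in_M a) (in_E b)))"
      using fun_cong[OF coact_compat, of m "\<lambda>a b c. B (in_D a) (in_M b) (in_E c)"] tDME
      by (simp add: tensor_lift_left_def tensor_lift_right_def)
    have splitL: "rcoact m (\<lambda>c z. lcoact c (\<lambda>a b. B (in_D a) (in_M b) (in_E z)) +
                              rcoact c (\<lambda>a b. B (in_M a) (in_E b) (in_E z))) =
        rcoact m (\<lambda>c z. lcoact c (\<lambda>a b. B (in_D a) (in_M b) (in_E z))) +
        rcoact m (\<lambda>c z. rcoact c (\<lambda>a b. B (in_M a) (in_E b) (in_E z)))"
      by (rule tensor_space_linear(1)[OF right.right_coact_in
        bilinear_lift_left[OF tDME left.linear_left_coact left.left_coact_in]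
        bilinear_lift_left[OF tMEE right.linear_right_coact right.right_coact_in]])
    have splitR: "lcoact m (\<lambda>z c. lcoact c (\<lambda>a b. B (in_D z) (in_D a) (in_M b)) +
                              rcoact c (\<lambda>a b. B (in_D z) (in_M a) (in_E b))) =
        lcoact m (\<lambda>z c. lcoact c (\<lambda>a b. B (in_D z) (in_D a) (in_M b))) +
        lcoact m (\<lambda>z c. rcoact c (\<lambda>a b. B (in_D z) (in_M a) (in_E b)))"
      by (rule tensor_space_linear(1)[OF left.left_coact_in
        bilinear_lift_right[OF tDDM left.linear_left_coact left.left_coact_in]
        bilinear_lift_right[OF tDME right.linear_right_coact right.right_coact_in]])
    have "tensor_lift_left sC sC sC comultC (comultC x) B =
        comultC x (\<lambda>c z. comultC c (\<lambda>a b. B a b z))"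
      using B by (simp add: tensor_lift_left_def)
    also have "\<dots> = comultC x (\<lambda>z c. comultC c (\<lambda>a b. B z a b))"
      unfolding x comultC_eval[OF L] comultC_eval[OF R] comultC_in[OF bl] comultC_in[OF br]
      by (simp only: splitL splitR DDD DDM MEE DME EEE ac_simps)
    also have "\<dots> = tensor_lift_right sC sC sC comultC (comultC x) B"
      using B by (simp add: tensor_lift_right_def)
    finally show ?thesis .
  qed (simp add: tensor_lift_left_def tensor_lift_right_def)
qed

lemma linear_counitC: "Vector_Spaces.linear sC (*) (tri_counit counitD counitE)"
  using vsC vector_space_field linear_additive[OF left.linear_counit]
    linear_additive[OF right.linear_counit] linear_scale[OF left.linear_counit]
    linear_scale[OF right.linear_counit]
  by (simp add: linear_iffs) (simp add: tri_counit_def sC_eq algebra_simps)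

lemma counit_in:
  "tri_counit counitD counitE (in_D d) = counitD d"
  "tri_counit counitD counitE (in_M m) = 0"
  "tri_counit counitD counitE (in_E e) = counitE e"
  by (simp_all add: tri_counit_def in_D_def in_M_def in_E_def
    linear_0[OF left.linear_counit] linear_0[OF right.linear_counit])

lemma vs_id: "vector_space s \<Longrightarrow> Vector_Spaces.linear s s id"
  by (simp add: linear_iffs)

lemma bilinear_zero:
  assumes "bilinear_map s t u B" shows "B 0 y = 0" "B x 0 = 0"
  using assms linear_0[of s u "\<lambda>v. B v y"] linear_0[of t u "\<lambda>w. B x w"]
  by (simp_all add: bilinear_map_def)

lemma in_sum: "(d :: 'd, m :: 'm, e :: 'e) = in_D d + in_M m + in_E e"
  by (simp add: in_D_def in_M_def in_E_def)

lemma tensor_zero: "T \<in> tensor_space s t UNIV UNIV \<Longrightarrow> T (\<lambda>v w. 0) = 0"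
  by (induction rule: tensor_space_induct) (simp_all add: fun_scale_def tensor_def)

theorem tri_coalgebra: "coalgebra sC comultC (tri_counit counitD counitE)"
proof (rule coalgebra.intro)
  let ?eps = "tri_counit counitD counitE"
  show "tensor_map (*) sC ?eps id (comultC x) = tensor (*) sC 1 x" for x
  proof
    fix B
    obtain d m e where x: "x = (d, m, e)" by (cases x)
    show "tensor_map (*) sC ?eps id (comultC x) B = tensor (*) sC 1 x B"
    proof (cases "bilinear_map (*) sC (*) B")
      case B: True
      have BC: "bilinear_map sC sC (*) (\<lambda>v w. B (?eps v) (id w))"
        by (rule bilinear_map_comp[OF B linear_counitC vs_id[OF vsC]])
      have DD: "comultD d (\<lambda>a b. B (counitD a) (in_D b)) = B 1 (in_D d)"
        using fun_cong[OF left.counit_left, of d "\<lambda>c a. B c (in_D a)"]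
          bilinear_map_comp[OF B vs_id[OF vector_space_field] linear_in(1)]
        by (simp add: tensor_map_def tensor_def)
      have MM: "lcoact m (\<lambda>a b. B (counitD a) (in_M b)) = B 1 (in_M m)"
        using fun_cong[OF left.left_coact_counit, of m "\<lambda>c a. B c (in_M a)"]
          bilinear_map_comp[OF B vs_id[OF vector_space_field] linear_in(2)]
        by (simp add: tensor_map_def tensor_def)
      have EE: "comultE e (\<lambda>a b. B (counitE a) (in_E b)) = B 1 (in_E e)"
        using fun_cong[OF right.counit_left, of e "\<lambda>c a. B c (in_E a)"]
          bilinear_map_comp[OF B vs_id[OF vector_space_field] linear_in(3)]
        by (simp add: tensor_map_def tensor_def)
      have "B 1 (in_D d + in_M m + in_E e) = B 1 (in_D d) + B 1 (in_M m) + B 1 (in_E e)"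
        using B linear_additive[of sC "(*)" "\<lambda>w. B 1 w"] by (simp add: bilinear_map_def)
      with B show ?thesis
        unfolding x in_sum[symmetric]
        by (simp add: tensor_map_def tensor_def comultC_eval[OF BC, simplified] counit_in
          bilinear_zero[OF B] DD MM EE tensor_zero[OF right.right_coact_in])
    qed (simp add: tensor_map_def tensor_def)
  qed
  show "tensor_map sC (*) id ?eps (comultC x) = tensor sC (*) x 1" for x
  proof
    fix B
    obtain d m e where x: "x = (d, m, e)" by (cases x)
    show "tensor_map sC (*) id ?eps (comultC x) B = tensor sC (*) x 1 B"
    proof (cases "bilinear_map sC (*) (*) B")
      case B: True
      have BC: "bilinear_map sC sC (*) (\<lambda>v w. B (id v) (?eps w))"
        by (rule bilinear_map_comp[OF B vs_id[OF vsC] linear_counitC])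
      have DD: "comultD d (\<lambda>a b. B (in_D a) (counitD b)) = B (in_D d) 1"
        using fun_cong[OF left.counit_right, of d "\<lambda>a c. B (in_D a) c"]
          bilinear_map_comp[OF B linear_in(1) vs_id[OF vector_space_field]]
        by (simp add: tensor_map_def tensor_def)
      have MM: "rcoact m (\<lambda>a b. B (in_M a) (counitE b)) = B (in_M m) 1"
        using fun_cong[OF right.right_coact_counit, of m "\<lambda>a c. B (in_M a) c"]
          bilinear_map_comp[OF B linear_in(2) vs_id[OF vector_space_field]]
        by (simp add: tensor_map_def tensor_def)
      have EE: "comultE e (\<lambda>a b. B (in_E a) (counitE b)) = B (in_E e) 1"
        using fun_cong[OF right.counit_right, of e "\<lambda>a c. B (in_E a) c"]
          bilinear_map_comp[OF B linear_in(3) vs_id[OF vector_space_field]]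
        by (simp add: tensor_map_def tensor_def)
      have "B (in_D d + in_M m + in_E e) 1 = B (in_D d) 1 + B (in_M m) 1 + B (in_E e) 1"
        using B linear_additive[of sC "(*)" "\<lambda>v. B v 1"] by (simp add: bilinear_map_def)
      with B show ?thesis
        unfolding x in_sum[symmetric]
        by (simp add: tensor_map_def tensor_def comultC_eval[OF BC, simplified] counit_in
          bilinear_zero[OF B] DD MM EE tensor_zero[OF left.left_coact_in])
    qed (simp add: tensor_map_def tensor_def)
  qed
qed (fact linear_comultC comultC_in_space linear_counitC coassocC)+

end

end

theory Submission
  imports Defs
begin

text \<open>
  Over a field, a subspace of a left comodule is a subcomodule iff it is closed under the operators
  \<open>m \<mapsto> \<phi>(m\<^sub>[\<^sub>-\<^sub>1\<^sub>]) m\<^sub>[\<^sub>0\<^sub>]\<close> for all functionals \<open>\<phi>\<close> of the coalgebra. As a left comodule, \<open>C\<close> has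
  the subcomodules \<open>E \<subseteq> M \<oplus> E\<close> with quotients \<open>M\<close> and \<open>D\<close>, so it is Artinian iff the left comodules
  \<open>D\<close>, \<open>M\<close> over \<open>D\<close> and \<open>E\<close> over \<open>E\<close> are. The maps \<open>m \<mapsto> \<psi>(m\<^sub>[\<^sub>0\<^sub>]) m\<^sub>[\<^sub>-\<^sub>1\<^sub>]\<close> from \<open>M\<close> to \<open>D\<close> have joint
  kernel \<open>0\<close>; if \<open>M\<close> is Artinian, finitely many of them already do, which embeds \<open>M\<close> in some \<open>D\<^sup>n\<close>.
  The right-hand statement is the left-hand one for the co-opposite of \<open>C\<close>, the comatrix coalgebra
  of the \<open>E\<^sup>c\<^sup>o\<^sup>p\<close>-\<open>D\<^sup>c\<^sup>o\<^sup>p\<close>-bicomodule \<open>M\<close>.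
\<close>

section \<open>Contraction of tensors\<close>

lemma linearD: "Vector_Spaces.linear s t f \<Longrightarrow> vector_space s"
  "Vector_Spaces.linear s t f \<Longrightarrow> vector_space t"
  by (simp_all add: linear_iffs)

text \<open>A nonzero difference \<open>x - y\<close> is an independent set by itself, so some
  functional takes the value 1 on it.\<close>

lemma linear_functionals_separate:
  fixes s :: "'k::field \<Rightarrow> 'v::ab_group_add \<Rightarrow> 'v"
  assumes s: "vector_space s" and eq: "\<And>\<phi>. Vector_Spaces.linear s (*) \<phi> \<Longrightarrow> \<phi> x = \<phi> y"
  shows "x = y"
proof (rule ccontr)
  assume "x \<noteq> y"
  interpret S: vector_space s by (rule s)
  interpret K: vector_space "(*) :: 'k \<Rightarrow> 'k \<Rightarrow> 'k" by (rule vector_space_field)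
  interpret SK: vector_space_pair s "(*) :: 'k \<Rightarrow> 'k \<Rightarrow> 'k" by unfold_locales
  have "S.independent {x - y}" using \<open>x \<noteq> y\<close> by simp
  then obtain \<phi> where \<phi>: "Vector_Spaces.linear s (*) \<phi>" "\<phi> (x - y) = (1::'k)"
    using SK.linear_independent_extend[of "{x - y}" "\<lambda>_. 1"] by auto
  then show False
    using eq[OF \<phi>(1)] linear_additive[OF \<phi>(1), of "x - y" y] by simp
qed

text \<open>This is \<phi> \<otimes> id followed by the identification of k \<otimes> W with W. The
  choice picks one of the linear extensions that \<open>tensor_universal\<close> provides; off the
  span of the pure tensors its values are arbitrary, so statements about values assume membership in
  \<open>tensor_space\<close>.\<close>

definition contract ::
  "('k::field \<Rightarrow> 'v::ab_group_add \<Rightarrow> 'v) \<Rightarrow> ('k \<Rightarrow> 'w::ab_group_add \<Rightarrow> 'w) \<Rightarrow>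
   ('v \<Rightarrow> 'k) \<Rightarrow> ('v, 'w, 'k) tensor \<Rightarrow> 'w" where
  "contract s t \<phi> = (SOME L. Vector_Spaces.linear tensor_scale t L \<and>
     (\<forall>v w. L (tensor s t v w) = t (\<phi> v) w))"

lemma
  assumes \<phi>: "Vector_Spaces.linear s (*) \<phi>" and t: "vector_space t"
  shows linear_contract: "Vector_Spaces.linear tensor_scale t (contract s t \<phi>)"
    and contract_tensor: "contract s t \<phi> (tensor s t v w) = t (\<phi> v) w"
proof -
  interpret T: vector_space t by (rule t)
  have "bilinear_map s t t (\<lambda>v w. t (\<phi> v) w)"
    using \<phi> t by (simp add: bilinear_map_def linear_iffs T.scale_left_distrib
      T.scale_right_distrib mult.commute)
  from someI_ex[OF tensor_universal[OF this]]
  show "Vector_Spaces.linear tensor_scale t (contract s t \<phi>)"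
    and "contract s t \<phi> (tensor s t v w) = t (\<phi> v) w"
    by (simp_all add: contract_def)
qed

lemma contract_in:
  assumes \<phi>: "Vector_Spaces.linear s (*) \<phi>" and t: "vector_space t"
    and N: "module.subspace t N" and T: "T \<in> tensor_space s t X N"
  shows "contract s t \<phi> T \<in> N"
proof -
  interpret vector_space t by (rule t)
  note L = linear_contract[OF \<phi> t]
  from T show ?thesis
  proof (induction rule: tensor_space_induct)
    case zero
    show ?case using N by (simp only: linear_0[OF L] subspace_0)
  next
    case (add S T)
    then show ?case using N by (simp only: linear_additive[OF L] subspace_add)
  next
    case (scale c T)
    then show ?case using N by (simp only: linear_scale[OF L] subspace_scale)
  next
    case (tensor v w)
    then show ?case using N by (simp only: contract_tensor[OF \<phi> t] subspace_scale)
  qed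
qed

text \<open>Brings contractions back to evaluation at a bilinear form. The axioms of coalgebras and
  comodules are equations between functions of forms, so they can then be applied directly.\<close>

lemma functional_contract:
  assumes \<phi>: "Vector_Spaces.linear s (*) \<phi>" and \<psi>: "Vector_Spaces.linear t (*) \<psi>"
    and T: "T \<in> tensor_space s t X Y"
  shows "\<psi> (contract s t \<phi> T) = T (\<lambda>v w. \<phi> v * \<psi> w)"
proof -
  note L = linear_contract[OF \<phi> linearD(1)[OF \<psi>]]
  have B: "bilinear_map s t (*) (\<lambda>v w. \<phi> v * \<psi> w)"
    using \<phi> \<psi> by (simp add: bilinear_map_def linear_iffs algebra_simps)
  from T show ?thesis
  proof (induction rule: tensor_space_induct)
    case zero
    show ?case unfolding linear_0[OF L] linear_0[OF \<psi>] by simp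
  next
    case (add S T)
    then show ?case unfolding linear_additive[OF L] linear_additive[OF \<psi>] by simp
  next
    case (scale c T)
    then show ?case unfolding linear_scale[OF L] linear_scale[OF \<psi>] by (simp add: fun_scale_def)
  next
    case (tensor v w)
    show ?case
      by (simp only: contract_tensor[OF \<phi> linearD(1)[OF \<psi>]] linear_scale[OF \<psi>])
        (simp add: tensor_def B)
  qed
qed

text \<open>Naturality of contraction: the map on the right factor comes out, the one on the left
  factor is absorbed into the functional. Both sides are linear in \<open>T\<close>, so pure tensors
  suffice.\<close>

lemma contract_tensor_map:
  assumes f: "Vector_Spaces.linear s s' f" and g: "Vector_Spaces.linear t t' g"
    and \<phi>: "Vector_Spaces.linear s' (*) \<phi>" and T: "T \<in> tensor_space s t X Y"
  shows "contract s' t' \<phi> (tensor_map s' t' f g T) = g (contract s t (\<lambda>v. \<phi> (f v)) T)"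
proof -
  have \<phi>f: "Vector_Spaces.linear s (*) (\<lambda>v. \<phi> (f v))"
    using Vector_Spaces.linear_compose[OF f \<phi>] by (simp add: o_def)
  note L = linear_contract[OF \<phi>f linearD(1)[OF g]]
    and L' = linear_contract[OF \<phi> linearD(2)[OF g]]
  from T show ?thesis
  proof (induction rule: tensor_space_induct)
    case zero
    show ?case
      by (simp only: linear_0[OF L] linear_0[OF L'] linear_0[OF g] linear_0[OF tensor_map_linear])
  next
    case (add S T)
    then show ?case
      by (simp only: linear_additive[OF L] linear_additive[OF L'] linear_additive[OF g]
        linear_additive[OF tensor_map_linear])
  next
    case (scale c T)
    then show ?case
      by (simp only: linear_scale[OF L] linear_scale[OF L'] linear_scale[OF g]
        linear_scale[OF tensor_map_linear])
  next
    case (tensor v w)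
    show ?case
      by (simp only: tensor_map_tensor[OF f g] contract_tensor[OF \<phi> linearD(2)[OF g]]
        contract_tensor[OF \<phi>f linearD(1)[OF g]] linear_scale[OF g])
  qed
qed

text \<open>The coefficients of the left factor with respect to \<open>S\<close> move across to the
  right factor; two expansions are added over the union of their index sets, padded with
  zeros.\<close>

lemma tensor_basis_expansion:
  assumes s: "vector_space s" and t: "vector_space t" and S: "module.span s S = UNIV"
    and T: "T \<in> tensor_space s t UNIV UNIV"
  shows "\<exists>A m. finite A \<and> A \<subseteq> S \<and> T = (\<Sum>b\<in>A. tensor s t b (m b))"
proof -
  interpret S: vector_space s by (rule s)
  interpret T: vector_space t by (rule t)
  interpret TT: vector_space "tensor_scale :: 'a \<Rightarrow> ('b, 'c, 'a) tensor \<Rightarrow> _"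
    by (rule vector_space_tensor_scale)
  note bil = bilinear_tensor[OF s t]
  have L1: "Vector_Spaces.linear s tensor_scale (\<lambda>v. tensor s t v w)"
    and L2: "Vector_Spaces.linear t tensor_scale (\<lambda>w. tensor s t v w)" for v w
    using bil by (simp_all add: bilinear_map_def)
  have extend: "(\<Sum>b\<in>A. tensor s t b (m b)) =
      (\<Sum>b\<in>A'. tensor s t b (if b \<in> A then m b else 0))" if "finite A'" "A \<subseteq> A'" for A A' m
    using that by (intro sum.mono_neutral_cong_left) (auto simp: linear_0[OF L2])
  from T show ?thesis
  proof (induction rule: tensor_space_induct)
    case zero
    show ?case by (intro exI[of _ "{}"]) simp
  next
    case (add T T')
    then obtain A m A' m' where A: "finite A" "A \<subseteq> S" "T = (\<Sum>b\<in>A. tensor s t b (m b))"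
      "finite A'" "A' \<subseteq> S" "T' = (\<Sum>b\<in>A'. tensor s t b (m' b))" by blast
    have "T + T' = (\<Sum>b\<in>A \<union> A'.
        tensor s t b ((if b \<in> A then m b else 0) + (if b \<in> A' then m' b else 0)))"
      unfolding A(3,6) using A(1,4) extend[of "A \<union> A'" A m] extend[of "A \<union> A'" A' m']
      by (simp add: sum.distrib linear_additive[OF L2])
    with A show ?case
      by (intro exI[of _ "A \<union> A'"]
          exI[of _ "\<lambda>b. (if b \<in> A then m b else 0) + (if b \<in> A' then m' b else 0)"]) auto
  next
    case (scale c T)
    then obtain A m where A: "finite A" "A \<subseteq> S" "T = (\<Sum>b\<in>A. tensor s t b (m b))" by blast
    then show ?case
      by (intro exI[of _ A] exI[of _ "\<lambda>b. t c (m b)"])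
        (simp add: linear_scale[OF L2] TT.scale_sum_right)
  next
    case (tensor v w)
    have "v \<in> S.span S" using S by simp
    then obtain A r where A: "finite A" "A \<subseteq> S" "v = (\<Sum>a\<in>A. s (r a) a)"
      unfolding S.span_explicit by blast
    interpret L1: Vector_Spaces.linear s tensor_scale "\<lambda>v. tensor s t v w" by (rule L1)
    have "tensor s t v w = (\<Sum>a\<in>A. tensor s t a (t (r a) w))"
      unfolding A(3) L1.sum by (simp add: L1.scale linear_scale[OF L2])
    with A(1,2) show ?case
      by (intro exI[of _ A] exI[of _ "\<lambda>a. t (r a) w"]) simp
  qed
qed

text \<open>Expand \<open>T\<close> over a basis \<open>S\<close> of the left factor. Contracting
  with the coordinate functional of \<open>a\<close> isolates the right-hand coefficient
  \<open>m a\<close>, so all coefficients lie in \<open>N\<close> as soon as all contractions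
  do.\<close>

lemma tensor_space_contract_iff:
  assumes s: "vector_space s" and t: "vector_space t" and N: "module.subspace t N"
    and T: "T \<in> tensor_space s t UNIV UNIV"
  shows "T \<in> tensor_space s t UNIV N \<longleftrightarrow>
    (\<forall>\<phi>. Vector_Spaces.linear s (*) \<phi> \<longrightarrow> contract s t \<phi> T \<in> N)"
proof safe
  fix \<phi> assume "T \<in> tensor_space s t UNIV N" "Vector_Spaces.linear s (*) \<phi>"
  then show "contract s t \<phi> T \<in> N" by (intro contract_in[OF _ t N])
next
  assume *: "\<forall>\<phi>. Vector_Spaces.linear s (*) \<phi> \<longrightarrow> contract s t \<phi> T \<in> N"
  interpret S: vector_space s by (rule s)
  interpret T: vector_space t by (rule t)
  interpret K: vector_space "(*) :: 'a \<Rightarrow> 'a \<Rightarrow> 'a" by (rule vector_space_field)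
  interpret SK: vector_space_pair s "(*) :: 'a \<Rightarrow> 'a \<Rightarrow> 'a" by unfold_locales
  interpret TT: vector_space "tensor_scale :: 'a \<Rightarrow> ('b, 'c, 'a) tensor \<Rightarrow> _"
    by (rule vector_space_tensor_scale)
  obtain S where S: "S.independent S" "S.span S = UNIV"
    using S.maximal_independent_subset[of UNIV] by (metis subset_antisym subset_UNIV)
  obtain A m where A: "finite A" "A \<subseteq> S" "T = (\<Sum>b\<in>A. tensor s t b (m b))"
    using tensor_basis_expansion[OF s t S(2) T] by blast
  have "m a \<in> N" if a: "a \<in> A" for a
  proof -
    obtain \<phi> where \<phi>: "Vector_Spaces.linear s (*) \<phi>" "\<And>b. b \<in> S \<Longrightarrow> \<phi> b = (if b = a then 1 else 0)"
      using SK.linear_independent_extend[OF S(1), of "\<lambda>b. if b = a then 1 else 0"] by blast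
    interpret L: Vector_Spaces.linear tensor_scale t "contract s t \<phi>"
      by (rule linear_contract[OF \<phi>(1) t])
    have "contract s t \<phi> T = (\<Sum>b\<in>A. t (\<phi> b) (m b))"
      unfolding A(3) L.sum by (simp add: contract_tensor[OF \<phi>(1) t])
    also have "\<dots> = (\<Sum>b\<in>A. if b = a then m b else 0)"
      using A(2) \<phi>(2) by (intro sum.cong) auto
    also have "\<dots> = m a" using A(1) a by simp
    finally show ?thesis using *[rule_format, OF \<phi>(1)] by simp
  qed
  then show "T \<in> tensor_space s t UNIV N"
    unfolding A(3) tensor_space_def by (intro TT.span_sum TT.span_base) blast
qed

section \<open>Subcomodules and homomorphisms in terms of the dual action\<close>

text \<open>Replaces membership in D \<otimes> N by stability of \<open>N\<close> under the
  operators that the functionals of \<open>D\<close> induce. All subcomodules below are checked in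
  this form.\<close>

lemma left_subcomodule_iff:
  assumes "vector_space sD" and "vector_space sM"
    and "\<And>m. coact m \<in> tensor_space sD sM UNIV UNIV"
  shows "left_subcomodule sD sM coact N \<longleftrightarrow> module.subspace sM N \<and>
    (\<forall>\<phi>. Vector_Spaces.linear sD (*) \<phi> \<longrightarrow> (\<forall>m\<in>N. contract sD sM \<phi> (coact m) \<in> N))"
  using tensor_space_contract_iff[OF assms(1,2) _ assms(3)]
  unfolding left_subcomodule_def by (auto simp: image_subset_iff)

lemma linear_id: "vector_space s \<Longrightarrow> Vector_Spaces.linear s s id"
  by (simp add: linear_iffs)

text \<open>Naturality of contraction with the identity on the coalgebra factor. It makes images and
  kernels of homomorphisms stable under the operators above.\<close>

lemma contract_left_comodule_hom:
  assumes f: "left_comodule_hom sD sM coactM sN coactN f" and \<phi>: "Vector_Spaces.linear sD (*) \<phi>"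
    and T: "coactM m \<in> tensor_space sD sM UNIV UNIV"
  shows "contract sD sN \<phi> (coactN (f m)) = f (contract sD sM \<phi> (coactM m))"
proof -
  have lin: "Vector_Spaces.linear sM sN f" and "coactN (f m) = tensor_map sD sN id f (coactM m)"
    using f by (simp_all add: left_comodule_hom_def)
  then show ?thesis
    using contract_tensor_map[OF linear_id[OF linearD(1)[OF \<phi>]] lin \<phi> T] by simp
qed

section \<open>Flipping tensors\<close>

text \<open>Transposition V \<otimes> W \<rightarrow> W \<otimes> V, dual to transposing the forms.
  Since this preserves bilinearity in both directions, no test for bilinearity is built in, and the
  map is an involution on all functions.\<close>

definition tensor_flip :: "('v, 'w, 'k) tensor \<Rightarrow> ('w, 'v, 'k) tensor" where
  "tensor_flip T = (\<lambda>B. T (\<lambda>v w. B w v))"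

lemma tensor_flip_flip [simp]: "tensor_flip (tensor_flip T) = T"
  by (simp add: tensor_flip_def)

lemma bilinear_map_flip: "bilinear_map s t u (\<lambda>v w. B w v) \<longleftrightarrow> bilinear_map t s u B"
  by (auto simp: bilinear_map_def)

lemma tensor_flip_tensor: "tensor_flip (tensor s t v w) = tensor t s w v"
proof
  fix B show "tensor_flip (tensor s t v w) B = tensor t s w v B"
    using bilinear_map_flip[of s t "(*)" B] by (simp add: tensor_flip_def tensor_def)
qed

lemma linear_tensor_flip:
  "Vector_Spaces.linear tensor_scale tensor_scale
     (tensor_flip :: ('v, 'w, 'k::field) tensor \<Rightarrow> ('w, 'v, 'k) tensor)"
  unfolding linear_iffs
proof (intro conjI allI vector_space_tensor_scale)
  show "tensor_flip (S + T) = tensor_flip S + tensor_flip T" for S T :: "('v, 'w, 'k) tensor"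
    by (rule ext) (simp add: tensor_flip_def)
  show "tensor_flip (tensor_scale c T) = tensor_scale c (tensor_flip T)"
    for c and T :: "('v, 'w, 'k) tensor"
    by (rule ext) (simp add: tensor_flip_def fun_scale_def)
qed

lemma tensor_flip_in:
  assumes "T \<in> tensor_space s t X Y"
  shows "tensor_flip T \<in> tensor_space t s Y X"
proof -
  interpret vector_space "tensor_scale" by (rule vector_space_tensor_scale)
  interpret L: Vector_Spaces.linear tensor_scale tensor_scale tensor_flip
    by (rule linear_tensor_flip)
  show ?thesis
    using assms
  proof (induction rule: tensor_space_induct)
    case (tensor v w)
    then show ?case
      unfolding tensor_flip_tensor tensor_space_def by (intro span_base) blast
  qed (simp_all only: L.zero L.add L.scale tensor_space_def span_zero span_add span_scale)
qed

lemma tensor_flip_in_iff: "tensor_flip T \<in> tensor_space t s Y X \<longleftrightarrow> T \<in> tensor_space s t X Y"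
  using tensor_flip_in[of T s t X Y] tensor_flip_in[of "tensor_flip T" t s Y X] by auto

lemma tensor_flip_map: "tensor_flip (tensor_map s t f g T) = tensor_map t s g f (tensor_flip T)"
proof
  fix B show "tensor_flip (tensor_map s t f g T) B = tensor_map t s g f (tensor_flip T) B"
    using bilinear_map_flip[of s t "(*)" B] by (simp add: tensor_flip_def tensor_map_def)
qed

section \<open>The descending chain condition\<close>

text \<open>Stated with a filter so that the stabilisation of several chains can be combined without
  handling the individual indices.\<close>

lemma dcc_eventually:
  assumes "descending_chain_condition Q" "\<And>i. Q (N i)" "decseq N"
  shows "\<exists>X. eventually (\<lambda>i. N i = X) sequentially"
  using assms(1)[unfolded descending_chain_condition_def, rule_format, of N] assms(2)
    decseq_SucD[OF assms(3)]
  unfolding eventually_sequentially by blast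

text \<open>The chain is decreasing, so only one of the two inclusions has to be supplied.\<close>

lemma dccI:
  assumes "\<And>N. (\<And>i. P (N i)) \<Longrightarrow> decseq N \<Longrightarrow> \<exists>n. \<forall>i\<ge>n. N n \<subseteq> N i"
  shows "descending_chain_condition P"
  unfolding descending_chain_condition_def
proof (intro allI impI)
  fix N :: "nat \<Rightarrow> 'a set" assume N: "(\<forall>i. P (N i)) \<and> (\<forall>i. N (Suc i) \<subseteq> N i)"
  then have dec: "decseq N" by (simp add: decseq_Suc_iff)
  then obtain n where "\<forall>i\<ge>n. N n \<subseteq> N i" using assms N by blast
  then show "\<exists>n. \<forall>i\<ge>n. N i = N n"
    using decseqD[OF dec] by (intro exI[of _ n]) (simp add: subset_antisym)
qed

text \<open>\<open>F\<close> preserves and reflects inclusion, so it sends a chain to a chain, and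
  stability of the image chain reflects back.\<close>

lemma dcc_pullback:
  assumes Q: "descending_chain_condition Q" and PQ: "\<And>A. P A \<Longrightarrow> Q (F A)"
    and mono: "\<And>A B. A \<subseteq> B \<Longrightarrow> F A \<subseteq> F B" and refl: "\<And>A B. F A \<subseteq> F B \<Longrightarrow> A \<subseteq> B"
  shows "descending_chain_condition P"
proof (rule dccI)
  fix N assume N: "\<And>i. P (N i)" "decseq N"
  then have "decseq (\<lambda>i. F (N i))" by (auto intro!: mono simp: decseq_def)
  then obtain X where "eventually (\<lambda>i. F (N i) = X) sequentially"
    using dcc_eventually[OF Q, of "\<lambda>i. F (N i)"] PQ N(1) by blast
  then obtain n where n: "F (N i) = X" if "i \<ge> n" for i
    unfolding eventually_sequentially by blast
  have "N n \<subseteq> N i" if "i \<ge> n" for i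
    by (rule refl) (simp add: n that)
  then show "\<exists>n. \<forall>i\<ge>n. N n \<subseteq> N i" by blast
qed

lemma dcc_minimal:
  assumes P: "descending_chain_condition P" and F: "\<And>A. A \<in> \<F> \<Longrightarrow> P A" and ne: "\<F> \<noteq> {}"
  shows "\<exists>A\<in>\<F>. \<forall>B\<in>\<F>. B \<subseteq> A \<longrightarrow> B = A"
proof (rule ccontr)
  assume "\<not> ?thesis"
  then have step: "\<exists>B. B \<in> \<F> \<and> B \<subset> A" if "A \<in> \<F>" for A using that by blast
  \<comment> \<open>Without a minimal element, dependent choice yields a strictly descending
    chain.\<close>
  have "\<exists>N. \<forall>n. N n \<in> \<F> \<and> N (Suc n) \<subset> N n"
    by (rule dependent_nat_choice) (use ne step in auto)
  then obtain N where N: "\<forall>n. N n \<in> \<F> \<and> N (Suc n) \<subset> N n" ..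
  have "\<exists>X. eventually (\<lambda>i. N i = X) sequentially"
  proof (rule dcc_eventually[OF P])
    show "P (N i)" for i using F N by simp
    show "decseq N" using N by (intro decseq_SucI) (simp add: psubset_imp_subset)
  qed
  then obtain X n where n: "\<forall>i\<ge>n. N i = X" unfolding eventually_sequentially by blast
  from n[THEN spec, of n] n[THEN spec, of "Suc n"] have "N (Suc n) = N n" by simp
  moreover have "N (Suc n) \<subset> N n" using N by blast
  ultimately show False by simp
qed

section \<open>Finitely cogenerated comodules\<close>

lemma linear_power_incl:
  assumes "vector_space s" shows "Vector_Spaces.linear s (fun_scale s) (power_incl i)"
proof -
  interpret vector_space s by (rule assms)
  show ?thesis
    using assms vector_space_fun_scale[OF assms]
    by (simp add: linear_iffs) (simp add: power_incl_def fun_scale_def fun_eq_iff)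
qed

lemma linear_component:
  assumes f: "Vector_Spaces.linear s (fun_scale t) f" and t: "vector_space t"
  shows "Vector_Spaces.linear s t (\<lambda>x. f x j)"
  using t linearD(1)[OF f] linear_additive[OF f] linear_scale[OF f]
  by (simp add: linear_iffs fun_scale_def)

lemma sum_power_incl: "j < n \<Longrightarrow> (\<Sum>i<n. power_incl i (h i)) j = h j"
  by (simp add: fun_sum_apply power_incl_def)

context left_comodule
begin

lemma vector_space_D: "vector_space scaleD" and vector_space_M: "vector_space scaleM"
  using linear_comult linear_left_coact by (simp_all add: linear_iffs)

text \<open>These are the operators \<open>d \<mapsto> \<phi>(d\<^sub>1) d\<^sub>2\<close> and
  \<open>m \<mapsto> \<phi>(m\<^sub>[\<^sub>-\<^sub>1\<^sub>])
  m\<^sub>[\<^sub>0\<^sub>]\<close>.\<close>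

abbreviation (input) "actD \<phi> d \<equiv> contract scaleD scaleD \<phi> (comultD d)"
abbreviation (input) "actM \<phi> m \<equiv> contract scaleD scaleM \<phi> (coact m)"

lemmas subcomodule_D_iff =
  left_subcomodule_iff[OF vector_space_D vector_space_D, of comultD, OF comult_in]
lemmas subcomodule_M_iff =
  left_subcomodule_iff[OF vector_space_D vector_space_M, of coact, OF left_coact_in]

text \<open>By naturality along the inclusions \<open>power_incl i\<close>, functionals act on the
  power of \<open>D\<close> coordinate by coordinate.\<close>

lemma contract_power_coact:
  assumes \<phi>: "Vector_Spaces.linear scaleD (*) \<phi>" and j: "j < n"
  shows "contract scaleD (fun_scale scaleD) \<phi> (left_power_coact scaleD comultD n h) j = actD \<phi> (h j)"
proof -
  interpret L: Vector_Spaces.linear tensor_scale "fun_scale scaleD :: _ \<Rightarrow> (nat \<Rightarrow> 'd) \<Rightarrow> _"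
      "contract scaleD (fun_scale scaleD) \<phi>"
    by (rule linear_contract[OF \<phi> vector_space_fun_scale[OF vector_space_D]])
  have "contract scaleD (fun_scale scaleD) \<phi> (left_power_coact scaleD comultD n h) =
      (\<Sum>i<n. power_incl i (actD \<phi> (h i)))"
    unfolding left_power_coact_def L.sum
      contract_tensor_map[OF linear_id[OF vector_space_D] linear_power_incl[OF vector_space_D] \<phi>
        comult_in] id_apply ..
  then show ?thesis using j by (simp only: sum_power_incl)
qed

text \<open>The subcomodule \<open>N\<close> is filtered by the joint kernels of \<open>f\<^sub>0, \<dots>, f\<^sub>j\<^sub>-\<^sub>1\<close>, and \<open>f\<^sub>j\<close>
  embeds the \<open>j\<close>-th quotient into \<open>D\<close>.\<close>

lemma artinian_if_joint_embedding:
  assumes D: "left_artinian_coalgebra scaleD comultD"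
    and f: "\<And>j. Vector_Spaces.linear scaleM scaleD (f j)"
    and comm: "\<And>j m \<phi>. j < (n::nat) \<Longrightarrow> Vector_Spaces.linear scaleD (*) \<phi> \<Longrightarrow>
                 f j (actM \<phi> m) = actD \<phi> (f j m)"
    and inj: "\<And>m. (\<And>j. j < n \<Longrightarrow> f j m = 0) \<Longrightarrow> m = 0"
  shows "left_artinian_comodule scaleD scaleM coact"
  unfolding left_artinian_comodule_def
proof (rule dccI)
  interpret M: vector_space scaleM by (rule vector_space_M)
  interpret D: vector_space scaleD by (rule vector_space_D)
  interpret f: Vector_Spaces.linear scaleM scaleD "f j" for j by (rule f)
  define part where "part j N = f j ` {m \<in> N. \<forall>i<j. f i m = 0}" for j N
  have part: "left_subcomodule scaleD scaleD comultD (part j N)"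
    if j: "j < n" and N: "left_subcomodule scaleD scaleM coact N" for j N
    unfolding subcomodule_D_iff
  proof (intro conjI allI impI ballI)
    have sub: "M.subspace N" using N by (simp add: left_subcomodule_def)
    then have "M.subspace {m \<in> N. \<forall>i<j. f i m = 0}"
      by (auto simp: M.subspace_def f.add f.scale)
    then show "D.subspace (part j N)"
      unfolding part_def by (rule f.subspace_image)
  next
    fix \<phi> d assume \<phi>: "Vector_Spaces.linear scaleD (*) \<phi>" and "d \<in> part j N"
    then obtain m where m: "m \<in> N" "\<And>i. i < j \<Longrightarrow> f i m = 0" "d = f j m"
      by (auto simp: part_def)
    have "actM \<phi> m \<in> N" using N m(1) \<phi> by (simp add: subcomodule_M_iff)
    \<comment> \<open>Each earlier \<open>f i\<close> commutes with the action, so its kernel is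
      stable.\<close>
    moreover have "f i (actM \<phi> m) = 0" if "i < j" for i
      using comm[of i \<phi> m] that j \<phi> m(2) linear_0[OF linear_comult]
        linear_0[OF linear_contract[OF \<phi> vector_space_D]] by simp
    ultimately show "actD \<phi> d \<in> part j N"
      using comm[OF j \<phi>, of m] m(3) by (force simp: part_def)
  qed
  fix N assume N: "\<And>i. left_subcomodule scaleD scaleM coact (N i)" and dec: "decseq N"
  have sub: "M.subspace (N i)" for i using N by (simp add: left_subcomodule_def)
  have "\<exists>X. eventually (\<lambda>i. part j (N i) = X) sequentially" if "j < n" for j
  proof (rule dcc_eventually)
    show "descending_chain_condition (left_subcomodule scaleD scaleD comultD)"
      using D by (simp add: left_artinian_coalgebra_def left_artinian_comodule_def)
    show "left_subcomodule scaleD scaleD comultD (part j (N i))" for i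
      using part that N by blast
    have "part j A \<subseteq> part j B" if "A \<subseteq> B" for A B using that by (auto simp: part_def)
    then show "decseq (\<lambda>i. part j (N i))" by (simp add: decseq_def decseqD[OF dec])
  qed
  then have "\<forall>j. \<exists>X. j < n \<longrightarrow> eventually (\<lambda>i. part j (N i) = X) sequentially" by blast
  from choice[OF this] obtain X
    where X: "\<And>j. j < n \<Longrightarrow> eventually (\<lambda>i. part j (N i) = X j) sequentially" by blast
  \<comment> \<open>There are only finitely many layers, so one index works for all of them.\<close>
  have "eventually (\<lambda>i. \<forall>j\<in>{..<n}. part j (N i) = X j) sequentially"
    by (rule eventually_ball_finite) (use X in auto)
  then obtain k where k: "\<And>i j. i \<ge> k \<Longrightarrow> j < n \<Longrightarrow> part j (N i) = X j"
    unfolding eventually_sequentially by blast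
  have "x \<in> N i" if i: "i \<ge> k" and x: "x \<in> N k" for i x
  proof -
    \<comment> \<open>Successive approximation of \<open>x\<close> within the smaller subcomodule:
      at stage \<open>j\<close> the first \<open>j\<close> coordinates of \<open>x\<close> and
      \<open>y\<close> agree.\<close>
    have "\<exists>y\<in>N i. \<forall>l<j. f l (x - y) = 0" if "j \<le> n" for j
      using that
    proof (induction j)
      case 0
      show ?case using M.subspace_0[OF sub] by blast
    next
      case (Suc j)
      then obtain y where y: "y \<in> N i" "\<And>l. l < j \<Longrightarrow> f l (x - y) = 0" by auto
      have "x - y \<in> N k" using y(1) x decseqD[OF dec i] M.subspace_diff[OF sub] by blast
      then have "f j (x - y) \<in> part j (N k)" using y(2) by (auto simp: part_def)
      also have "part j (N k) = part j (N i)" using k Suc.prems i by simp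
      finally obtain z where z: "z \<in> N i" "\<And>l. l < j \<Longrightarrow> f l z = 0" "f j (x - y) = f j z"
        by (auto simp: part_def)
      \<comment> \<open>The correction \<open>z\<close> settles coordinate \<open>j\<close> and
        vanishes under all earlier ones, so nothing already achieved is lost.\<close>
      have "f l (x - (y + z)) = 0" if "l < Suc j" for l
        using that y(2)[of l] z(2)[of l] z(3) f.diff[of l "x - y" z]
        by (cases "l = j") (simp_all add: diff_diff_eq)
      with y(1) z(1) show ?case using M.subspace_add[OF sub] by blast
    qed
    from this[OF order_refl] obtain y where y: "y \<in> N i" "\<And>l. l < n \<Longrightarrow> f l (x - y) = 0"
      by blast
    from inj[OF y(2)] have "x - y = 0" by simp
    with y(1) show ?thesis by simp
  qed
  then show "\<exists>k. \<forall>i\<ge>k. N k \<subseteq> N i" by blast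
qed

text \<open>The coordinates of an embedding into the \<open>n\<close>-th power of \<open>D\<close>
  form a joint embedding into \<open>D\<close>.\<close>

lemma artinian_if_finitely_cogenerated:
  assumes D: "left_artinian_coalgebra scaleD comultD"
    and M: "left_finitely_cogenerated scaleD comultD scaleM coact"
  shows "left_artinian_comodule scaleD scaleM coact"
proof -
  obtain n f where f: "inj f" "range f \<subseteq> power_space n"
    "left_comodule_hom scaleD scaleM coact (fun_scale scaleD) (left_power_coact scaleD comultD n) f"
    using M by (auto simp: left_finitely_cogenerated_def)
  have lin: "Vector_Spaces.linear scaleM (fun_scale scaleD) f"
    using f(3) by (simp add: left_comodule_hom_def)
  show ?thesis
  proof (rule artinian_if_joint_embedding[OF D, where f = "\<lambda>j m. f m j" and n = n])
    show "Vector_Spaces.linear scaleM scaleD (\<lambda>m. f m j)" for j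
      by (rule linear_component[OF lin vector_space_D])
    show "f (actM \<phi> m) j = actD \<phi> (f m j)"
      if "j < n" "Vector_Spaces.linear scaleD (*) \<phi>" for j m \<phi>
      using contract_left_comodule_hom[OF f(3) that(2) left_coact_in, of m]
        contract_power_coact[OF that(2,1), of "f m"] by simp
    show "m = 0" if "\<And>j. j < n \<Longrightarrow> f m j = 0" for m
    proof -
      have "f m \<in> power_space n" using f(2) by blast
      \<comment> \<open>Coordinates from \<open>n\<close> on vanish by membership in
        \<open>power_space n\<close>.\<close>
      then have "f m j = 0" for j
        using that by (cases "j < n") (simp_all add: power_space_def)
      then have "f m = f 0" by (auto simp: linear_0[OF lin])
      with f(1) show ?thesis by (simp add: inj_eq)
    qed
  qed
qed

text \<open>This is the map \<open>m \<mapsto> \<psi>(m\<^sub>[\<^sub>0\<^sub>]) m\<^sub>[\<^sub>-\<^sub>1\<^sub>]\<close>.\<close>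

definition matrix_map :: "('m \<Rightarrow> 'k) \<Rightarrow> 'm \<Rightarrow> 'd" where
  "matrix_map \<psi> m = contract scaleM scaleD \<psi> (tensor_flip (coact m))"

lemma linear_matrix_map:
  assumes "Vector_Spaces.linear scaleM (*) \<psi>"
  shows "Vector_Spaces.linear scaleM scaleD (matrix_map \<psi>)"
  using Vector_Spaces.linear_compose[OF
      Vector_Spaces.linear_compose[OF linear_left_coact linear_tensor_flip]
      linear_contract[OF assms vector_space_D]]
  by (simp add: matrix_map_def[abs_def] o_def)

text \<open>Tests \<open>matrix_map\<close> against functionals, which separate points, and
  expresses the result by the coaction itself.\<close>

lemma functional_matrix_map:
  assumes \<psi>: "Vector_Spaces.linear scaleM (*) \<psi>" and \<chi>: "Vector_Spaces.linear scaleD (*) \<chi>"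
  shows "\<chi> (matrix_map \<psi> m) = coact m (\<lambda>d m'. \<psi> m' * \<chi> d)"
  unfolding matrix_map_def functional_contract[OF \<psi> \<chi> tensor_flip_in[OF left_coact_in]]
  by (simp add: tensor_flip_def)

text \<open>This is the counit axiom paired with \<psi>. It puts the kernel of
  \<open>matrix_map \<psi>\<close> inside that of \<psi>, which makes these maps jointly
  injective.\<close>

lemma counit_matrix_map:
  assumes \<psi>: "Vector_Spaces.linear scaleM (*) \<psi>"
  shows "counitD (matrix_map \<psi> m) = \<psi> m"
proof -
  have B: "bilinear_map (*) scaleM (*) (\<lambda>c m. \<psi> m * c)"
    using \<psi> vector_space_field by (simp add: bilinear_map_def linear_iffs algebra_simps)
  from fun_cong[OF left_coact_counit, of m "\<lambda>c m. \<psi> m * c"] show ?thesis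
    by (simp add: functional_matrix_map[OF \<psi> linear_counit] tensor_map_def tensor_def B)
qed

text \<open>Coassociativity of the coaction with \<psi> applied to the last tensor factor.\<close>

lemma matrix_map_hom:
  assumes \<psi>: "Vector_Spaces.linear scaleM (*) \<psi>"
  shows "left_comodule_hom scaleD scaleM coact scaleD comultD (matrix_map \<psi>)"
  unfolding left_comodule_hom_def
proof (intro conjI allI linear_matrix_map[OF \<psi>] ext)
  fix m B
  show "comultD (matrix_map \<psi> m) B = tensor_map scaleD scaleD id (matrix_map \<psi>) (coact m) B"
  proof (cases "bilinear_map scaleD scaleD (*) B")
    case B: True
    have B2: "Vector_Spaces.linear scaleD (*) (B d)" for d
      using B by (simp add: bilinear_map_def)
    \<comment> \<open>For fixed \<open>B\<close>, evaluating the comultiplication at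
      \<open>B\<close> is a functional on \<open>D\<close>; this allows
      \<open>functional_matrix_map\<close> to be used.\<close>
    have \<chi>: "Vector_Spaces.linear scaleD (*) (\<lambda>c. comultD c B)"
      using vector_space_D vector_space_field linear_additive[OF linear_comult]
        linear_scale[OF linear_comult]
      by (simp add: linear_iffs fun_scale_def)
    \<comment> \<open>This is the form at which coassociativity is evaluated.\<close>
    have tri: "trilinear_map scaleD scaleD scaleM (*) (\<lambda>a b x. \<psi> x * B a b)"
      using B \<psi> by (simp add: trilinear_map_def bilinear_map_def linear_iffs algebra_simps)
    have "comultD (matrix_map \<psi> m) B = coact m (\<lambda>d x. comultD d (\<lambda>a b. \<psi> x * B a b))"
      unfolding functional_matrix_map[OF \<psi> \<chi>] tensor_space_linear(2)[OF comult_in B] ..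
    also have "\<dots> = coact m (\<lambda>d x. coact x (\<lambda>a b. \<psi> b * B d a))"
      using fun_cong[OF left_coact_coassoc, of m "\<lambda>a b x. \<psi> x * B a b"]
      by (simp add: tensor_lift_left_def tensor_lift_right_def tri)
    also have "\<dots> = coact m (\<lambda>d x. B d (matrix_map \<psi> x))"
      unfolding functional_matrix_map[OF \<psi> B2] ..
    also have "\<dots> = tensor_map scaleD scaleD id (matrix_map \<psi>) (coact m) B"
      by (simp add: tensor_map_def B)
    finally show ?thesis .
  next
    case False
    then show ?thesis
      using tensor_space_linear(3)[OF comult_in False] by (simp add: tensor_map_def)
  qed
qed

text \<open>Homomorphisms commute with the dual action, so their kernels are stable under it, and so
  are intersections of kernels. The chain condition thereby applies to such kernels.\<close>

lemma subcomodule_joint_kernel: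
  assumes F: "\<And>\<psi>. \<psi> \<in> F \<Longrightarrow> Vector_Spaces.linear scaleM (*) \<psi>"
  shows "left_subcomodule scaleD scaleM coact {m. \<forall>\<psi>\<in>F. matrix_map \<psi> m = 0}"
proof -
  interpret M: vector_space scaleM by (rule vector_space_M)
  have "M.subspace {m. \<forall>\<psi>\<in>F. matrix_map \<psi> m = 0}"
    using linear_0[OF linear_matrix_map[OF F]] linear_additive[OF linear_matrix_map[OF F]]
      linear_scale[OF linear_matrix_map[OF F]] module.scale_zero_right[of scaleD]
      vector_space_D[folded module_iff_vector_space]
    by (simp add: M.subspace_def)
  moreover have "matrix_map \<psi> (actM \<phi> m) = 0"
    if "\<psi> \<in> F" "Vector_Spaces.linear scaleD (*) \<phi>" "matrix_map \<psi> m = 0" for \<psi> \<phi> m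
    using contract_left_comodule_hom[OF matrix_map_hom[OF F[OF that(1)]] that(2) left_coact_in, of m]
      linear_0[OF linear_comult] linear_0[OF linear_contract[OF that(2) vector_space_D]] that(3)
    by simp
  ultimately show ?thesis by (simp add: subcomodule_M_iff)
qed

section \<open>Embedding an Artinian comodule into a finite power\<close>

text \<open>A family of homomorphisms to \<open>D\<close> assembles into one to its power. The
  equation is checked at each bilinear \<open>B\<close>, where both sides split into sums over the
  coordinates.\<close>

lemma left_comodule_hom_power:
  fixes f :: "nat \<Rightarrow> 'm \<Rightarrow> 'd"
  assumes f: "\<And>i. left_comodule_hom scaleD scaleM coact scaleD comultD (f i)"
  shows "left_comodule_hom scaleD scaleM coact (fun_scale scaleD) (left_power_coact scaleD comultD n)
    (\<lambda>m. \<Sum>i<n. power_incl i (f i m))"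
proof -
  interpret P: vector_space "fun_scale scaleD :: _ \<Rightarrow> (nat \<Rightarrow> 'd) \<Rightarrow> _"
    by (rule vector_space_fun_scale[OF vector_space_D])
  have lf: "Vector_Spaces.linear scaleM scaleD (f i)" for i
    using f by (simp add: left_comodule_hom_def)
  have lin: "Vector_Spaces.linear scaleM (fun_scale scaleD) (\<lambda>m. \<Sum>i<n. power_incl i (f i m))"
    using vector_space_M P.vector_space_axioms
    by (simp add: linear_iffs linear_additive[OF lf] linear_scale[OF lf]
        linear_additive[OF linear_power_incl[OF vector_space_D]]
        linear_scale[OF linear_power_incl[OF vector_space_D]] sum.distrib P.scale_sum_right)
  have "left_power_coact scaleD comultD n (\<Sum>i<n. power_incl i (f i m)) =
      tensor_map scaleD (fun_scale scaleD) id (\<lambda>m. \<Sum>i<n. power_incl i (f i m)) (coact m)" for m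
  proof
    fix B :: "'d \<Rightarrow> (nat \<Rightarrow> 'd) \<Rightarrow> 'k"
    let ?s = "fun_scale scaleD"
    show "left_power_coact scaleD comultD n (\<Sum>i<n. power_incl i (f i m)) B =
      tensor_map scaleD ?s id (\<lambda>m. \<Sum>i<n. power_incl i (f i m)) (coact m) B"
    proof (cases "bilinear_map scaleD ?s (*) B")
      case B: True
      have B1: "bilinear_map scaleD scaleD (*) (\<lambda>a b. B a (power_incl i b))" for i
        using bilinear_map_comp[OF B linear_id[OF vector_space_D] linear_power_incl[OF vector_space_D]]
        by simp
      have B2: "bilinear_map scaleD scaleM (*) (\<lambda>a x. B a (power_incl i (f i x)))" for i
        using bilinear_map_comp[OF B1 linear_id[OF vector_space_D] lf] by simp
      have Bsum: "B a (\<Sum>i<k. g i) = (\<Sum>i<k. B a (g i))" for a g and k :: nat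
      proof -
        have L: "Vector_Spaces.linear ?s (*) (B a)" using B by (simp add: bilinear_map_def)
        show ?thesis
          by (induction k) (simp_all only: sum.lessThan_Suc lessThan_0 sum.empty linear_0[OF L]
            linear_additive[OF L])
      qed
      have B3: "bilinear_map scaleD scaleM (*) (\<lambda>a x. \<Sum>i<k. B a (power_incl i (f i x)))" for k
        using B2 vector_space_D vector_space_M vector_space_field
        by (simp add: bilinear_map_def linear_iffs sum.distrib sum_distrib_left)
      have T: "coact m (\<lambda>a x. \<Sum>i<k. B a (power_incl i (f i x))) =
          (\<Sum>i<k. coact m (\<lambda>a x. B a (power_incl i (f i x))))" for k
      proof (induction k)
        case 0
        \<comment> \<open>The empty sum is the zero form, obtained by scaling a bilinear form with
          0.\<close>
        show ?case using tensor_space_linear(2)[OF left_coact_in B2, of m 0] by simp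
      next
        case (Suc k)
        then show ?case by (simp add: tensor_space_linear(1)[OF left_coact_in B3 B2])
      qed
      have "comultD (f i m) (\<lambda>a b. B a (power_incl i b)) =
          coact m (\<lambda>a x. B a (power_incl i (f i x)))" for i
        using f[of i] B1[of i] by (simp add: left_comodule_hom_def tensor_map_def)
      then show ?thesis
        by (simp add: left_power_coact_def fun_sum_apply[of _ _ B] tensor_map_def B sum_power_incl
          T Bsum)
    qed (simp add: left_power_coact_def fun_sum_apply tensor_map_def)
  qed
  with lin show ?thesis by (simp add: left_comodule_hom_def)
qed

text \<open>Among the joint kernels of finitely many \<open>matrix_map \<psi>\<close> there is a
  minimal one. Adding any further functional cannot shrink it, so every functional vanishes on it
  and it is zero.\<close>

lemma finitely_cogenerated_if_artinian:
  assumes "left_artinian_comodule scaleD scaleM coact"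
  shows "left_finitely_cogenerated scaleD comultD scaleM coact"
proof -
  define Ker where "Ker F = {m. \<forall>\<psi>\<in>F. matrix_map \<psi> m = 0}" for F
  define fam where "fam = {F. finite F \<and> (\<forall>\<psi>\<in>F. Vector_Spaces.linear scaleM (*) \<psi>)}"
  have "\<exists>A\<in>Ker ` fam. \<forall>B\<in>Ker ` fam. B \<subseteq> A \<longrightarrow> B = A"
  proof (rule dcc_minimal)
    show "descending_chain_condition (left_subcomodule scaleD scaleM coact)"
      using assms by (simp add: left_artinian_comodule_def)
    show "left_subcomodule scaleD scaleM coact A" if "A \<in> Ker ` fam" for A
      using that subcomodule_joint_kernel by (auto simp: Ker_def fam_def)
    have "{} \<in> fam" by (simp add: fam_def)
    then show "Ker ` fam \<noteq> {}" by blast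
  qed
  then obtain F where F: "F \<in> fam" and "\<forall>B\<in>Ker ` fam. B \<subseteq> Ker F \<longrightarrow> B = Ker F"
    by auto
  then have min: "G \<in> fam \<Longrightarrow> Ker G \<subseteq> Ker F \<Longrightarrow> Ker G = Ker F" for G by simp
  have inj: "m = 0" if m: "m \<in> Ker F" for m
  proof (rule linear_functionals_separate[OF vector_space_M])
    fix \<psi> assume \<psi>: "Vector_Spaces.linear scaleM (*) \<psi>"
    have "Ker (insert \<psi> F) = Ker F"
      using F \<psi> by (intro min) (auto simp: fam_def Ker_def)
    with m have "matrix_map \<psi> m = 0" by (auto simp: Ker_def)
    then show "\<psi> m = \<psi> 0"
      using counit_matrix_map[OF \<psi>, of m] linear_0[OF \<psi>] linear_0[OF linear_counit] by simp
  qed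
  have "finite F" using F by (simp add: fam_def)
  then obtain xs where xs: "set xs = F" using finite_list by blast
  \<comment> \<open>The leading zero functional guarantees a positive exponent even if
    \<open>F\<close> is empty.\<close>
  define ys where "ys = (\<lambda>_. 0) # xs"
  have zero: "Vector_Spaces.linear scaleM (*) (\<lambda>_. 0)"
    by (simp add: linear_iffs vector_space_M vector_space_field)
  then have ys: "Vector_Spaces.linear scaleM (*) (ys ! i)" if "i < length ys" for i
    using nth_mem[OF that] F xs by (auto simp: ys_def fam_def simp del: nth_mem)
  define n where "n = length ys"
  \<comment> \<open>Indices from \<open>n\<close> on get the zero functional, so that every
    \<open>g i\<close> is a homomorphism.\<close>
  define g where "g i = matrix_map (if i < n then ys ! i else (\<lambda>_. 0))" for i
  have g: "left_comodule_hom scaleD scaleM coact scaleD comultD (g i)" for i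
    unfolding g_def using ys zero by (intro matrix_map_hom) (simp add: n_def)
  define f where "f m = (\<Sum>i<n. power_incl i (g i m))" for m
  have hom: "left_comodule_hom scaleD scaleM coact (fun_scale scaleD)
      (left_power_coact scaleD comultD n) f"
    unfolding f_def[abs_def] by (rule left_comodule_hom_power[OF g])
  then have lin: "Vector_Spaces.linear scaleM (fun_scale scaleD) f"
    by (simp add: left_comodule_hom_def)
  have "range f \<subseteq> power_space n"
    by (auto simp: f_def power_space_def fun_sum_apply power_incl_def)
  moreover have "inj f"
  proof -
    have "m = 0" if m: "f m = 0" for m
    proof (rule inj)
      have "matrix_map (ys ! i) m = 0" if "i < n" for i
        using fun_cong[OF m, of i] that
        by (simp add: f_def sum_power_incl) (simp add: g_def)
      moreover have "\<psi> \<in> set ys" if "\<psi> \<in> F" for \<psi> using that xs by (simp add: ys_def)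
      ultimately show "m \<in> Ker F" by (fastforce simp: Ker_def n_def in_set_conv_nth)
    qed
    then show ?thesis
      using module_hom.inj_iff_eq_0[OF lin[folded module_hom_iff_linear]] by blast
  qed
  moreover have "n > 0" by (simp add: n_def ys_def)
  ultimately show ?thesis using hom by (auto simp: left_finitely_cogenerated_def)
qed

end

section \<open>Left subcomodules of the comatrix coalgebra\<close>

context bicomodule
begin

abbreviation (input) "actD \<phi> d \<equiv> contract scaleD scaleD \<phi> (comultD d)"
abbreviation (input) "actE \<phi> e \<equiv> contract scaleE scaleE \<phi> (comultE e)"
abbreviation (input) "lactM \<phi> m \<equiv> contract scaleD scaleM \<phi> (lcoact m)"

lemmas subcomodule_C_iff = left_subcomodule_iff[OF vsC vsC, of comultC, OF comultC_in_space]
lemmas subcomodule_E_iff = left_subcomodule_iff[OF vsE vsE, of comultE, OF right.comult_in]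

text \<open>The dual action is triangular: the \<open>M\<close>-part feeds into \<open>E\<close>
  through the right coaction, and there is no other mixing. This exhibits \<open>E\<close> and M
  \<oplus> E as subcomodules with the expected quotients.\<close>

lemma contract_comultC:
  assumes \<phi>: "Vector_Spaces.linear sC (*) \<phi>"
  shows "contract sC sC \<phi> (comultC (d, m, e)) =
    (actD (\<lambda>a. \<phi> (in_D a)) d, lactM (\<lambda>a. \<phi> (in_D a)) m,
     contract scaleM scaleE (\<lambda>a. \<phi> (in_M a)) (rcoact m) + actE (\<lambda>a. \<phi> (in_E a)) e)"
proof -
  note L = linear_contract[OF \<phi> vsC]
  have "contract sC sC \<phi> (comultC (d, m, e)) =
      in_D (actD (\<lambda>a. \<phi> (in_D a)) d) + (in_M (lactM (\<lambda>a. \<phi> (in_D a)) m) +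
      in_E (contract scaleM scaleE (\<lambda>a. \<phi> (in_M a)) (rcoact m))) +
      in_E (actE (\<lambda>a. \<phi> (in_E a)) e)"
    unfolding tri_comult_def Let_def prod.case linear_additive[OF L]
      contract_tensor_map[OF linear_in(1) linear_in(1) \<phi> left.comult_in]
      contract_tensor_map[OF linear_in(1) linear_in(2) \<phi> left.left_coact_in]
      contract_tensor_map[OF linear_in(2) linear_in(3) \<phi> right.right_coact_in]
      contract_tensor_map[OF linear_in(3) linear_in(3) \<phi> right.comult_in] ..
  then show ?thesis by (simp add: in_D_def in_M_def in_E_def)
qed

lemma linear_restrict:
  assumes "Vector_Spaces.linear sC (*) \<phi>"
  shows "Vector_Spaces.linear scaleD (*) (\<lambda>a. \<phi> (in_D a))"
    and "Vector_Spaces.linear scaleM (*) (\<lambda>a. \<phi> (in_M a))"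
    and "Vector_Spaces.linear scaleE (*) (\<lambda>a. \<phi> (in_E a))"
  using Vector_Spaces.linear_compose[OF linear_in(1) assms]
    Vector_Spaces.linear_compose[OF linear_in(2) assms]
    Vector_Spaces.linear_compose[OF linear_in(3) assms] by (simp_all add: o_def)

text \<open>Extension by zero along a projection realises every functional of \<open>D\<close> or
  \<open>E\<close> as the restriction of one on \<open>C\<close>.\<close>

lemma linear_extend:
  shows "Vector_Spaces.linear scaleD (*) \<phi> \<Longrightarrow> Vector_Spaces.linear sC (*) (\<lambda>x. \<phi> (fst x))"
    and "Vector_Spaces.linear scaleE (*) \<psi> \<Longrightarrow> Vector_Spaces.linear sC (*) (\<lambda>x. \<psi> (snd (snd x)))"
  using vsC by (simp_all add: linear_iffs sC_eq split_beta)

lemma act_zero: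
  "Vector_Spaces.linear scaleD (*) \<phi> \<Longrightarrow> actD \<phi> 0 = 0"
  "Vector_Spaces.linear scaleD (*) \<phi> \<Longrightarrow> lactM \<phi> 0 = 0"
  "Vector_Spaces.linear scaleM (*) \<chi> \<Longrightarrow> contract scaleM scaleE \<chi> (rcoact 0) = 0"
  "Vector_Spaces.linear scaleE (*) \<psi> \<Longrightarrow> actE \<psi> 0 = 0"
  unfolding zeros
  by (simp_all only: linear_0[OF linear_contract] vsD vsM vsE)

lemma subspace_C_iff:
  "module.subspace sC N \<longleftrightarrow> 0 \<in> N \<and> (\<forall>x\<in>N. \<forall>y\<in>N. x + y \<in> N) \<and>
    (\<forall>c d m e. (d, m, e) \<in> N \<longrightarrow> (scaleD c d, scaleM c m, scaleE c e) \<in> N)"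
proof -
  interpret C: vector_space sC by (rule vsC)
  have "(\<forall>c. \<forall>x\<in>N. sC c x \<in> N) \<longleftrightarrow>
      (\<forall>c d m e. (d, m, e) \<in> N \<longrightarrow> (scaleD c d, scaleM c m, scaleE c e) \<in> N)"
    by (simp add: sC_eq Ball_def)
  then show ?thesis by (simp only: C.subspace_def)
qed

section \<open>Subcomodules of the comatrix coalgebra built from those of its summands\<close>

lemma subcomodule_C_D:
  assumes N: "left_subcomodule scaleD scaleD comultD N"
  shows "left_subcomodule sC sC comultC (N \<times> {0} \<times> {0})"
proof -
  interpret D: vector_space scaleD by (rule vsD)
  from N show ?thesis
    by (auto simp: subcomodule_C_iff subspace_C_iff left.subcomodule_D_iff D.subspace_def
      contract_comultC linear_restrict act_zero zero_scale zero_prod_def)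
qed

text \<open>All of \<open>E\<close> is included because the action may move elements of
  \<open>M\<close> into \<open>E\<close>; the set is the preimage of \<open>N\<close> in M \<oplus>
  E.\<close>

lemma subcomodule_C_M:
  assumes N: "left_subcomodule scaleD scaleM lcoact N"
  shows "left_subcomodule sC sC comultC ({0} \<times> N \<times> UNIV)"
proof -
  interpret M: vector_space scaleM by (rule vsM)
  from N show ?thesis
    by (auto simp: subcomodule_C_iff subspace_C_iff left.subcomodule_M_iff M.subspace_def
      contract_comultC linear_restrict act_zero zero_scale zero_prod_def)
qed

lemma subcomodule_C_E:
  assumes N: "left_subcomodule scaleE scaleE comultE N"
  shows "left_subcomodule sC sC comultC ({0} \<times> {0} \<times> N)"
proof -
  interpret E: vector_space scaleE by (rule vsE)
  from N show ?thesis
    by (auto simp: subcomodule_C_iff subspace_C_iff subcomodule_E_iff E.subspace_def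
      contract_comultC linear_restrict act_zero zero_scale zero_prod_def)
qed

section \<open>The three layers of a subcomodule of the comatrix coalgebra\<close>

text \<open>This layer is the image of \<open>N\<close> in the quotient of \<open>C\<close> by M
  \<oplus> E. A functional of \<open>D\<close> acts on it as its extension by zero acts on
  \<open>N\<close>.\<close>

lemma subcomodule_part_D:
  assumes N: "left_subcomodule sC sC comultC N"
  shows "left_subcomodule scaleD scaleD comultD (fst ` N)"
proof -
  interpret D: vector_space scaleD by (rule vsD)
  interpret C: vector_space sC by (rule vsC)
  interpret fst: Vector_Spaces.linear sC scaleD fst
    using vsC vsD by (simp add: linear_iffs sC_eq split_beta)
  have "D.subspace (fst ` N)"
    using N by (intro fst.subspace_image) (simp add: left_subcomodule_def)
  moreover have "actD \<phi> d \<in> fst ` N"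
    if \<phi>: "Vector_Spaces.linear scaleD (*) \<phi>" and "d \<in> fst ` N" for \<phi> d
  proof -
    obtain m e where "(d, m, e) \<in> N" using \<open>d \<in> fst ` N\<close> by force
    then have "contract sC sC (\<lambda>x. \<phi> (fst x)) (comultC (d, m, e)) \<in> N"
      using N linear_extend(1)[OF \<phi>] by (simp add: subcomodule_C_iff)
    from imageI[OF this, of fst] show ?thesis
      unfolding contract_comultC[OF linear_extend(1)[OF \<phi>]] by (simp add: in_D_def)
  qed
  ultimately show ?thesis by (simp add: left.subcomodule_D_iff)
qed

text \<open>This layer is the image of N \<inter> (M \<oplus> E) in the quotient of M \<oplus> E by
  \<open>E\<close>.\<close>

lemma subcomodule_part_M:
  assumes N: "left_subcomodule sC sC comultC N"
  shows "left_subcomodule scaleD scaleM lcoact {m. \<exists>e. (0, m, e) \<in> N}"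
proof -
  interpret M: vector_space scaleM by (rule vsM)
  have sub: "0 \<in> N" "\<And>x y. x \<in> N \<Longrightarrow> y \<in> N \<Longrightarrow> x + y \<in> N"
    "\<And>c d m e. (d, m, e) \<in> N \<Longrightarrow> (scaleD c d, scaleM c m, scaleE c e) \<in> N"
    using N by (simp_all add: left_subcomodule_def subspace_C_iff)
  have "M.subspace {m. \<exists>e. (0, m, e) \<in> N}"
    unfolding M.subspace_def
  proof (intro conjI ballI allI)
    show "0 \<in> {m. \<exists>e. (0, m, e) \<in> N}" using sub(1) by (auto simp: zero_prod_def)
    show "m + m' \<in> {m. \<exists>e. (0, m, e) \<in> N}"
      if "m \<in> {m. \<exists>e. (0, m, e) \<in> N}" "m' \<in> {m. \<exists>e. (0, m, e) \<in> N}" for m m'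
      using that sub(2)[of "(0, m, _)" "(0, m', _)"] by auto
    show "scaleM c m \<in> {m. \<exists>e. (0, m, e) \<in> N}" if "m \<in> {m. \<exists>e. (0, m, e) \<in> N}" for c m
      using that sub(3)[of 0 m _ c] by (auto simp: zero_scale)
  qed
  moreover have "\<exists>e. (0, lactM \<phi> m, e) \<in> N"
    if \<phi>: "Vector_Spaces.linear scaleD (*) \<phi>" and "(0, m, e) \<in> N" for \<phi> m e
  proof -
    have "contract sC sC (\<lambda>x. \<phi> (fst x)) (comultC (0, m, e)) \<in> N"
      using N linear_extend(1)[OF \<phi>] that(2) by (simp add: subcomodule_C_iff)
    then show ?thesis
      unfolding contract_comultC[OF linear_extend(1)[OF \<phi>]]
      by (auto simp: in_D_def act_zero(1)[OF \<phi>])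
  qed
  ultimately show ?thesis by (auto simp: left.subcomodule_M_iff)
qed

lemma subcomodule_part_E:
  assumes N: "left_subcomodule sC sC comultC N"
  shows "left_subcomodule scaleE scaleE comultE {e. (0, 0, e) \<in> N}"
proof -
  interpret E: vector_space scaleE by (rule vsE)
  have sub: "0 \<in> N" "\<And>x y. x \<in> N \<Longrightarrow> y \<in> N \<Longrightarrow> x + y \<in> N"
    "\<And>c d m e. (d, m, e) \<in> N \<Longrightarrow> (scaleD c d, scaleM c m, scaleE c e) \<in> N"
    using N by (simp_all add: left_subcomodule_def subspace_C_iff)
  have "E.subspace {e. (0, 0, e) \<in> N}"
    unfolding E.subspace_def
  proof (intro conjI ballI allI)
    show "0 \<in> {e. (0, 0, e) \<in> N}" using sub(1) by (simp add: zero_prod_def)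
    show "e + e' \<in> {e. (0, 0, e) \<in> N}"
      if "e \<in> {e. (0, 0, e) \<in> N}" "e' \<in> {e. (0, 0, e) \<in> N}" for e e'
      using that sub(2)[of "(0, 0, e)" "(0, 0, e')"] by simp
    show "scaleE c e \<in> {e. (0, 0, e) \<in> N}" if "e \<in> {e. (0, 0, e) \<in> N}" for c e
      using that sub(3)[of 0 0 e c] by (simp add: zero_scale)
  qed
  moreover have "(0, 0, actE \<psi> e) \<in> N"
    if \<psi>: "Vector_Spaces.linear scaleE (*) \<psi>" and "(0, 0, e) \<in> N" for \<psi> e
  proof -
    have "contract sC sC (\<lambda>x. \<psi> (snd (snd x))) (comultC (0, 0, e)) \<in> N"
      using N linear_extend(2)[OF \<psi>] that(2) by (simp add: subcomodule_C_iff)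
    then show ?thesis
      unfolding contract_comultC[OF linear_extend(2)[OF \<psi>]]
        act_zero(1,2)[OF linear_restrict(1)[OF linear_extend(2)[OF \<psi>]]]
        act_zero(3)[OF linear_restrict(2)[OF linear_extend(2)[OF \<psi>]]]
      by (simp add: in_E_def)
  qed
  ultimately show ?thesis by (simp add: subcomodule_E_iff)
qed

text \<open>An element of \<open>N\<close> is corrected by elements of \<open>N'\<close> in one
  coordinate after the other, first in \<open>D\<close>, then in \<open>M\<close>; the remainder
  lies in the common \<open>E\<close>-layer.\<close>

lemma subcomodule_C_eqI:
  assumes N: "left_subcomodule sC sC comultC N" and N': "left_subcomodule sC sC comultC N'"
    and sub: "N' \<subseteq> N" and D: "fst ` N = fst ` N'"
    and M: "{m. \<exists>e. (0, m, e) \<in> N} = {m. \<exists>e. (0, m, e) \<in> N'}"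
    and E: "{e. (0, 0, e) \<in> N} = {e. (0, 0, e) \<in> N'}"
  shows "N \<subseteq> N'"
proof
  interpret C: vector_space sC by (rule vsC)
  have s: "C.subspace N" "C.subspace N'" using N N' by (simp_all add: left_subcomodule_def)
  fix x assume x: "x \<in> N"
  obtain d m e where x_eq: "x = (d, m, e)" by (cases x)
  have "d \<in> fst ` N'" using D x x_eq by force
  then obtain m' e' where y: "(d, m', e') \<in> N'" by force
  then have "(d, m, e) - (d, m', e') \<in> N" using sub x x_eq by (intro C.subspace_diff[OF s(1)]) auto
  then have xy: "(0, m - m', e - e') \<in> N" by simp
  then have "m - m' \<in> {m. \<exists>e. (0, m, e) \<in> N'}" using M by auto
  then obtain e'' where z: "(0, m - m', e'') \<in> N'" by blast
  with xy sub have "(0, m - m', e - e') - (0, m - m', e'') \<in> N"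
    by (intro C.subspace_diff[OF s(1)]) auto
  then have "(0, 0, e - e' - e'') \<in> N'" using E by auto
  \<comment> \<open>\<open>x\<close> is the sum of the remainder and the two corrections, all three
    in \<open>N'\<close>.\<close>
  from C.subspace_add[OF s(2) this C.subspace_add[OF s(2) y z]]
  show "x \<in> N'" by (simp add: x_eq)
qed

text \<open>Forwards, chains in each summand embed into chains in \<open>C\<close>. Backwards, the
  three layers of a chain in \<open>C\<close> stabilise, and nested subcomodules with equal layers
  coincide.\<close>

lemma left_artinian_C_iff:
  "left_artinian_coalgebra sC comultC \<longleftrightarrow>
     left_artinian_coalgebra scaleD comultD \<and> left_artinian_coalgebra scaleE comultE \<and>
     left_artinian_comodule scaleD scaleM lcoact"
  unfolding left_artinian_coalgebra_def left_artinian_comodule_def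
proof safe
  assume C: "descending_chain_condition (left_subcomodule sC sC comultC)"
  show "descending_chain_condition (left_subcomodule scaleD scaleD comultD)"
    by (rule dcc_pullback[OF C subcomodule_C_D]) auto
  show "descending_chain_condition (left_subcomodule scaleE scaleE comultE)"
    by (rule dcc_pullback[OF C subcomodule_C_E]) auto
  show "descending_chain_condition (left_subcomodule scaleD scaleM lcoact)"
    by (rule dcc_pullback[OF C subcomodule_C_M]) auto
next
  assume D: "descending_chain_condition (left_subcomodule scaleD scaleD comultD)"
    and E: "descending_chain_condition (left_subcomodule scaleE scaleE comultE)"
    and M: "descending_chain_condition (left_subcomodule scaleD scaleM lcoact)"
  show "descending_chain_condition (left_subcomodule sC sC comultC)"
  proof (rule dccI)
    fix N assume N: "\<And>i. left_subcomodule sC sC comultC (N i)" and dec: "decseq N"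
    have le: "N j \<subseteq> N i" if "i \<le> j" for i j using decseqD[OF dec that] .
    have "decseq (\<lambda>i. fst ` N i)"
      unfolding decseq_def using le by (intro allI impI image_mono)
    from dcc_eventually[OF D subcomodule_part_D[OF N] this]
    obtain XD where XD: "eventually (\<lambda>i. fst ` N i = XD) sequentially" ..
    have "decseq (\<lambda>i. {m. \<exists>e. (0, m, e) \<in> N i})"
      unfolding decseq_def using le by (intro allI impI Collect_mono) blast
    from dcc_eventually[OF M subcomodule_part_M[OF N] this]
    obtain XM where XM: "eventually (\<lambda>i. {m. \<exists>e. (0, m, e) \<in> N i} = XM) sequentially" ..
    have "decseq (\<lambda>i. {e. (0, 0, e) \<in> N i})"
      unfolding decseq_def using le by (intro allI impI Collect_mono) blast
    from dcc_eventually[OF E subcomodule_part_E[OF N] this]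
    obtain XE where XE: "eventually (\<lambda>i. {e. (0, 0, e) \<in> N i} = XE) sequentially" ..
    from eventually_conj[OF XD eventually_conj[OF XM XE]]
    obtain n where n: "\<And>i. i \<ge> n \<Longrightarrow> fst ` N i = XD \<and> {m. \<exists>e. (0, m, e) \<in> N i} = XM \<and>
        {e. (0, 0, e) \<in> N i} = XE"
      unfolding eventually_sequentially by blast
    have "N n \<subseteq> N i" if "i \<ge> n" for i
      by (rule subcomodule_C_eqI[OF N N le[OF that]]) (simp_all only: n[OF that] n[OF order_refl])
    then show "\<exists>n. \<forall>i\<ge>n. N n \<subseteq> N i" by blast
  qed
qed

text \<open>Over a left Artinian \<open>D\<close>, the comodule \<open>M\<close> is Artinian exactly
  when it is finitely cogenerated.\<close>

lemma left_artinian_C_iff_cogenerated: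
  "left_artinian_coalgebra sC comultC \<longleftrightarrow>
     left_artinian_coalgebra scaleD comultD \<and> left_artinian_coalgebra scaleE comultE \<and>
     left_finitely_cogenerated scaleD comultD scaleM lcoact"
  using left_artinian_C_iff left.artinian_if_finitely_cogenerated
    left.finitely_cogenerated_if_artinian by blast

end

section \<open>Co-opposite coalgebras\<close>

definition tensor3_flip :: "('v, 'w, 'x, 'k) tensor3 \<Rightarrow> ('x, 'w, 'v, 'k) tensor3" where
  "tensor3_flip T = (\<lambda>B. T (\<lambda>v w x. B x w v))"

lemma trilinear_map_flip:
  "trilinear_map r s t u (\<lambda>v w x. B x w v) \<longleftrightarrow> trilinear_map t s r u B"
  by (auto simp: trilinear_map_def)

text \<open>Together with its mirror image below, this shows that flipping exchanges the two sides
  of a coassociativity law up to reversing the triple tensor product.\<close>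

lemma tensor_lift_left_flip:
  "tensor_lift_left r s t (\<lambda>v. tensor_flip (f v)) (tensor_flip T) =
     tensor3_flip (tensor_lift_right t s r f T)"
proof
  fix B
  show "tensor_lift_left r s t (\<lambda>v. tensor_flip (f v)) (tensor_flip T) B =
      tensor3_flip (tensor_lift_right t s r f T) B"
    using trilinear_map_flip[of t s r "(*)" B]
    by (simp add: tensor_lift_left_def tensor_lift_right_def tensor_flip_def tensor3_flip_def)
qed

lemma tensor_lift_right_flip:
  "tensor_lift_right r s t (\<lambda>v. tensor_flip (f v)) (tensor_flip T) =
     tensor3_flip (tensor_lift_left t s r f T)"
proof
  fix B
  show "tensor_lift_right r s t (\<lambda>v. tensor_flip (f v)) (tensor_flip T) B =
      tensor3_flip (tensor_lift_left t s r f T) B"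
    using trilinear_map_flip[of t s r "(*)" B]
    by (simp add: tensor_lift_left_def tensor_lift_right_def tensor_flip_def tensor3_flip_def)
qed

lemma linear_flip_comp:
  "Vector_Spaces.linear s tensor_scale f \<Longrightarrow> Vector_Spaces.linear s tensor_scale (\<lambda>v. tensor_flip (f v))"
  using Vector_Spaces.linear_compose[OF _ linear_tensor_flip] by (simp add: o_def)

text \<open>Flipping interchanges the two sides of coassociativity and the two counit
  axioms.\<close>

lemma (in coalgebra) coalgebra_cop: "coalgebra scale (\<lambda>c. tensor_flip (comult c)) counit"
  by (rule coalgebra.intro)
    (simp_all only: linear_flip_comp[OF linear_comult] tensor_flip_in[OF comult_in] linear_counit
      tensor_lift_left_flip tensor_lift_right_flip coassoc tensor_flip_map[symmetric] counit_left counit_right tensor_flip_tensor)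

lemma (in left_comodule) right_comodule_cop:
  "right_comodule scaleD (\<lambda>c. tensor_flip (comultD c)) counitD scaleM (\<lambda>m. tensor_flip (coact m))"
  by (intro right_comodule.intro right_comodule_axioms.intro coalgebra_cop)
    (simp_all only: linear_flip_comp[OF linear_left_coact] tensor_flip_in[OF left_coact_in]
      tensor_lift_left_flip tensor_lift_right_flip left_coact_coassoc tensor_flip_map[symmetric] left_coact_counit
      tensor_flip_tensor)

lemma (in right_comodule) left_comodule_cop:
  "left_comodule scaleE (\<lambda>c. tensor_flip (comultE c)) counitE scaleM (\<lambda>m. tensor_flip (coact m))"
  by (intro left_comodule.intro left_comodule_axioms.intro coalgebra_cop)
    (simp_all only: linear_flip_comp[OF linear_right_coact] tensor_flip_in[OF right_coact_in]
      tensor_lift_left_flip tensor_lift_right_flip right_coact_coassoc tensor_flip_map[symmetric] right_coact_counit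
      tensor_flip_tensor)

text \<open>\<open>D\<close> and \<open>E\<close> exchange roles, and the compatibility of the two
  coactions is its own mirror image.\<close>

lemma (in bicomodule) bicomodule_cop:
  "bicomodule scaleE (\<lambda>c. tensor_flip (comultE c)) counitE scaleD (\<lambda>c. tensor_flip (comultD c)) counitD
     scaleM (\<lambda>m. tensor_flip (rcoact m)) (\<lambda>m. tensor_flip (lcoact m))"
  by (intro bicomodule.intro bicomodule_axioms.intro right.left_comodule_cop left.right_comodule_cop)
    (simp only: tensor_lift_left_flip tensor_lift_right_flip coact_compat)

lemma right_subcomodule_flip:
  "left_subcomodule s t (\<lambda>m. tensor_flip (coact m)) = right_subcomodule s t coact"
  by (rule ext) (auto simp: left_subcomodule_def right_subcomodule_def image_subset_iff tensor_flip_in_iff)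

lemma right_artinian_coalgebra_flip:
  "left_artinian_coalgebra s (\<lambda>c. tensor_flip (comult c)) \<longleftrightarrow> right_artinian_coalgebra s comult"
  by (simp add: left_artinian_coalgebra_def right_artinian_coalgebra_def
    left_artinian_comodule_def right_artinian_comodule_def right_subcomodule_flip)

text \<open>Flipping is linear, so it passes through the sum defining the power coaction, and
  injective, so it cancels in the homomorphism equation. The same embedding serves both
  sides.\<close>

lemma right_finitely_cogenerated_flip:
  "left_finitely_cogenerated sE (\<lambda>c. tensor_flip (comultE c)) sM (\<lambda>m. tensor_flip (coact m)) \<longleftrightarrow>
     right_finitely_cogenerated sE comultE sM coact"
proof -
  have inj: "tensor_flip S = tensor_flip T \<longleftrightarrow> S = T" for S T :: "(nat \<Rightarrow> 'b, 'b, 'a) tensor"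
    by (metis tensor_flip_flip)
  have "left_power_coact sE (\<lambda>c. tensor_flip (comultE c)) n h =
      tensor_flip (right_power_coact sE comultE n h)" for n h
  proof -
    interpret Vector_Spaces.linear "tensor_scale :: 'a \<Rightarrow> (nat \<Rightarrow> 'b, 'b, 'a) tensor \<Rightarrow> _"
        tensor_scale tensor_flip
      by (rule linear_tensor_flip)
    show ?thesis
      by (simp only: left_power_coact_def right_power_coact_def sum tensor_flip_map)
  qed
  then show ?thesis
    by (simp add: left_finitely_cogenerated_def right_finitely_cogenerated_def
      left_comodule_hom_def right_comodule_hom_def tensor_flip_map[symmetric] inj)
qed

section \<open>Reversing the summands of the comatrix coalgebra\<close>

lemma tensor_map_in_image:
  assumes T: "T \<in> tensor_space s t X Y" and f: "Vector_Spaces.linear s s' f"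
    and g: "Vector_Spaces.linear t t' g" and sub: "f ` X \<subseteq> X'" "g ` Y \<subseteq> Y'"
  shows "tensor_map s' t' f g T \<in> tensor_space s' t' X' Y'"
proof -
  interpret vector_space "tensor_scale" by (rule vector_space_tensor_scale)
  interpret L: Vector_Spaces.linear tensor_scale tensor_scale "tensor_map s' t' f g"
    by (rule tensor_map_linear)
  from T show ?thesis
  proof (induction rule: tensor_space_induct)
    case (tensor v w)
    then show ?case
      unfolding tensor_map_tensor[OF f g] tensor_space_def using sub by (intro span_base) blast
  qed (simp_all only: L.zero L.add L.scale tensor_space_def span_zero span_add span_scale)
qed

text \<open>The comatrix coalgebra of the co-opposite bicomodule lives on E \<oplus> M \<oplus> D;
  this map identifies the two underlying spaces.\<close>

definition swap3 :: "'a \<times> 'b \<times> 'c \<Rightarrow> 'c \<times> 'b \<times> 'a" where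
  "swap3 = (\<lambda>(a, b, c). (c, b, a))"

lemma swap3_swap3 [simp]: "swap3 (swap3 x) = x"
  by (cases x) (simp add: swap3_def)

lemma swap3_image_subset_iff: "swap3 ` A \<subseteq> swap3 ` B \<longleftrightarrow> A \<subseteq> B"
  by (rule inj_image_subset_iff) (metis injI swap3_swap3)

lemma swap3_in: "swap3 (in_D d) = in_E d" "swap3 (in_M m) = in_M m" "swap3 (in_E e) = in_D e"
  by (simp_all add: swap3_def in_D_def in_M_def in_E_def)

context bicomodule
begin

interpretation cop: bicomodule scaleE "\<lambda>c. tensor_flip (comultE c)" counitE
    scaleD "\<lambda>c. tensor_flip (comultD c)" counitD
    scaleM "\<lambda>m. tensor_flip (rcoact m)" "\<lambda>m. tensor_flip (lcoact m)"
  by (rule bicomodule_cop)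

abbreviation (input) "sC' \<equiv> tri_scale scaleE scaleM scaleD"
abbreviation (input) "comultC' \<equiv> tri_comult scaleE (\<lambda>c. tensor_flip (comultE c))
  scaleD (\<lambda>c. tensor_flip (comultD c)) scaleM (\<lambda>m. tensor_flip (rcoact m)) (\<lambda>m. tensor_flip (lcoact m))"

lemma linear_swap3: "Vector_Spaces.linear sC sC' swap3"
  using vsC cop.vsC by (simp add: linear_iffs) (simp add: swap3_def sC_eq cop.sC_eq split_beta)

text \<open>Thus \<open>swap3\<close> identifies the co-opposite of \<open>C\<close> with the
  comatrix coalgebra of the co-opposite bicomodule: the summands D \<otimes> D and E \<otimes> E of
  the comultiplication trade places, as do D \<otimes> M and M \<otimes> E.\<close>

lemma comultC_swap3: "comultC' (swap3 x) = tensor_map sC' sC' swap3 swap3 (tensor_flip (comultC x))"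
proof
  fix B
  obtain d m e where x: "x = (d, m, e)" by (cases x)
  show "comultC' (swap3 x) B = tensor_map sC' sC' swap3 swap3 (tensor_flip (comultC x)) B"
  proof (cases "bilinear_map sC' sC' (*) B")
    case B: True
    have B': "bilinear_map sC sC (*) (\<lambda>v w. B (swap3 w) (swap3 v))"
      using bilinear_map_comp[OF B linear_swap3 linear_swap3]
        bilinear_map_flip[of sC sC "(*)" "\<lambda>v w. B (swap3 v) (swap3 w)"] by simp
    have "comultC' (swap3 x) B = comultC' (e, m, d) B" by (simp add: x swap3_def)
    also have "\<dots> = comultC x (\<lambda>v w. B (swap3 w) (swap3 v))"
      unfolding cop.comultC_eval[OF B] x comultC_eval[OF B']
      by (simp only: swap3_in tensor_flip_def ac_simps)
    finally show ?thesis by (simp add: tensor_map_def B tensor_flip_def)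
  next
    case False
    then show ?thesis
      \<comment> \<open>Off the bilinear forms both sides have the default value 0.\<close>
      using tensor_space_linear(3)[OF cop.comultC_in_space False] by (simp add: tensor_map_def)
  qed
qed

lemma swap3_subspace:
  assumes "module.subspace sC N" shows "module.subspace sC' (swap3 ` N)"
proof -
  interpret Vector_Spaces.linear sC sC' swap3 by (rule linear_swap3)
  show ?thesis using assms by (rule subspace_image)
qed

lemma right_subcomodule_swap3:
  assumes "right_subcomodule sC sC comultC N"
  shows "left_subcomodule sC' sC' comultC' (swap3 ` N)"
  using assms swap3_subspace
  by (auto simp: left_subcomodule_def right_subcomodule_def comultC_swap3 image_subset_iff
    intro!: tensor_map_in_image[OF tensor_flip_in linear_swap3 linear_swap3])

text \<open>Applied to the co-opposite bicomodule, whose own co-opposite is the original one, this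
  carries left subcomodules of the reversed coalgebra back to right subcomodules of
  \<open>C\<close>.\<close>

lemma left_subcomodule_swap3:
  assumes "left_subcomodule sC sC comultC N"
  shows "right_subcomodule sC' sC' comultC' (swap3 ` N)"
  using assms swap3_subspace
  by (auto simp: left_subcomodule_def right_subcomodule_def comultC_swap3 image_subset_iff
    intro!: tensor_map_in_image[OF tensor_flip_in linear_swap3 linear_swap3])

end

context bicomodule
begin

text \<open>Renewed so that the facts on \<open>swap3\<close> proved above hold for the co-opposite
  bicomodule as well.\<close>

interpretation cop: bicomodule scaleE "\<lambda>c. tensor_flip (comultE c)" counitE
    scaleD "\<lambda>c. tensor_flip (comultD c)" counitD
    scaleM "\<lambda>m. tensor_flip (rcoact m)" "\<lambda>m. tensor_flip (lcoact m)"
  by (rule bicomodule_cop)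

text \<open>Taking images under \<open>swap3\<close> preserves and reflects inclusion in both
  directions, so the chain conditions on the two sides agree.\<close>

lemma right_artinian_C_iff:
  "right_artinian_coalgebra sC comultC \<longleftrightarrow> left_artinian_coalgebra sC' comultC'"
  unfolding left_artinian_coalgebra_def right_artinian_coalgebra_def
    left_artinian_comodule_def right_artinian_comodule_def
proof
  assume C: "descending_chain_condition (right_subcomodule sC sC comultC)"
  show "descending_chain_condition (left_subcomodule sC' sC' comultC')"
    by (rule dcc_pullback[OF C, where F = "image swap3"])
      (simp_all only: cop.left_subcomodule_swap3[unfolded tensor_flip_flip] swap3_image_subset_iff)
next
  assume C: "descending_chain_condition (left_subcomodule sC' sC' comultC')"
  show "descending_chain_condition (right_subcomodule sC sC comultC)"
    by (rule dcc_pullback[OF C, where F = "image swap3"])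
      (simp_all only: right_subcomodule_swap3 swap3_image_subset_iff)
qed

text \<open>The left-hand equivalence for the co-opposite bicomodule, with every flip undone; there
  \<open>E\<close> takes the place of \<open>D\<close>.\<close>

lemma right_artinian_C_iff_cogenerated:
  "right_artinian_coalgebra sC comultC \<longleftrightarrow>
     right_artinian_coalgebra scaleD comultD \<and> right_artinian_coalgebra scaleE comultE \<and>
     right_finitely_cogenerated scaleE comultE scaleM rcoact"
  unfolding right_artinian_C_iff cop.left_artinian_C_iff_cogenerated
    right_artinian_coalgebra_flip right_finitely_cogenerated_flip by blast

end

theorem proposition2p5:
  fixes scaleD :: "'k::field \<Rightarrow> 'd::ab_group_add \<Rightarrow> 'd"
    and comultD :: "'d \<Rightarrow> ('d, 'd, 'k) tensor" and counitD :: "'d \<Rightarrow> 'k"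
    and scaleE :: "'k \<Rightarrow> 'e::ab_group_add \<Rightarrow> 'e"
    and comultE :: "'e \<Rightarrow> ('e, 'e, 'k) tensor" and counitE :: "'e \<Rightarrow> 'k"
    and scaleM :: "'k \<Rightarrow> 'm::ab_group_add \<Rightarrow> 'm"
    and lcoact :: "'m \<Rightarrow> ('d, 'm, 'k) tensor" and rcoact :: "'m \<Rightarrow> ('m, 'e, 'k) tensor"
  assumes "coalgebra scaleD comultD counitD"
    and "coalgebra scaleE comultE counitE"
    and "bicomodule scaleD comultD counitD scaleE comultE counitE scaleM lcoact rcoact"
  shows "(left_artinian_coalgebra (tri_scale scaleD scaleM scaleE)
           (tri_comult scaleD comultD scaleE comultE scaleM lcoact rcoact) \<longleftrightarrow>
         left_artinian_coalgebra scaleD comultD \<and> left_artinian_coalgebra scaleE comultE \<and>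
         left_finitely_cogenerated scaleD comultD scaleM lcoact) \<and>
         (right_artinian_coalgebra (tri_scale scaleD scaleM scaleE)
           (tri_comult scaleD comultD scaleE comultE scaleM lcoact rcoact) \<longleftrightarrow>
         right_artinian_coalgebra scaleD comultD \<and> right_artinian_coalgebra scaleE comultE \<and>
         right_finitely_cogenerated scaleE comultE scaleM rcoact)"
  using bicomodule.left_artinian_C_iff_cogenerated[OF assms(3)]
    bicomodule.right_artinian_C_iff_cogenerated[OF assms(3)] by blast

end
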